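(* Let $b$ be prime, let $\alpha>1$ be an integer, let $s\ge 1$ and $1\le m\le n$ be integers, let $\boldsymbol\gamma=(\gamma_1,\gamma_2,\ldots)$ be a sequence of positive weights, let $p(X)\in\mathbb F_b[X]$ be irreducible with $\deg(p)=n$, and let $q_1(X),\ldots,q_s(X)\in\mathbb F_b[X]$. Let $\boldsymbol x_h=(x_{h,1},\ldots,x_{h,s})$, $0\le h<b^m$, be the points of the polynomial lattice rule with generating vector $(q_1(X),\ldots,q_s(X))$ modulo $p(X)$, and let $e_{b^m,\alpha}((q_1(X),\ldots,q_s(X)),p(X))$ be the worst-case integration error of this rule in the Walsh space $\mathcal W_{\alpha,s,\boldsymbol\gamma}$. Then $$e_{b^m,\alpha}((q_1(X),\ldots,q_s(X)),p(X)) = -1+\frac1{b^m}\sum_{h=0}^{b^m-1}\prod_{j=1}^s\bigl(1+\gamma_j\,\omega_\alpha(x_{h,j})\bigr),$$ where $\omega_\alpha(x):=\sum_{k=1}^\infty r_\alpha(k)\,\mathrm{wal}_k(x)$ for $x\in[0,1)$.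
   Context: Digits. Write $k\in\mathbb N_0=\{0,1,2,\ldots\}$ in base $b$ as $k=\sum_{i=0}^a\kappa_i b^i$, $\kappa_i\in\{0,\ldots,b-1\}$. Write $x\in[0,1)$ as $x=\sum_{i\ge1}\xi_i b^{-i}$, $\xi_i\in\{0,\ldots,b-1\}$, not all but finitely many $\xi_i$ equal to $b-1$. Let $\#k$ be the number of non-zero base $b$ digits of $k$ ($\#0=0$), and write $k=\sum_{i=1}^{\#k}\kappa_{a_i}b^{a_i}$ with $\kappa_{a_i}\in\{1,\ldots,b-1\}$ and $a_1>\cdots>a_{\#k}\ge0$. Walsh functions. $\mathrm{wal}_k(x)=\exp(2\pi\mathrm i(\xi_1\kappa_0+\cdots+\xi_{a+1}\kappa_a)/b)$, and for $\boldsymbol k\in\mathbb N_0^s$, $\boldsymbol x\in[0,1)^s$, $\mathrm{wal}_{\boldsymbol k}(\boldsymbol x)=\prod_{j=1}^s\mathrm{wal}_{k_j}(x_j)$. Decay function. $r_\alpha(k)=b^{-\sum_{i=1}^{\min(\#k,\alpha)}(a_i+1)}$ for $k\ge1$; $r_\alpha(\boldsymbol\gamma,\boldsymbol k)=\prod_{j:\,k_j\ne0}\gamma_j\,r_\alpha(k_j)$, with value $1$ for $\boldsymbol k=\boldsymbol0$. Function space. $\mathcal W_{\alpha,s,\boldsymbol\gamma}$ is the space of functions $f$ on $[0,1)^s$ equal pointwise to an absolutely convergent Walsh series $f(\boldsymbol x)=\sum_{\boldsymbol k\in\mathbb N_0^s}\widehat f_{\boldsymbol k}\,\mathrm{wal}_{\boldsymbol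 k}(\boldsymbol x)$, $\widehat f_{\boldsymbol k}=\int_{[0,1]^s}f(\boldsymbol x)\overline{\mathrm{wal}_{\boldsymbol k}(\boldsymbol x)}\,d\boldsymbol x$, with finite norm $\|f\|=\sup_{\boldsymbol k\in\mathbb N_0^s}|\widehat f_{\boldsymbol k}|/r_\alpha(\boldsymbol\gamma,\boldsymbol k)$. Worst-case error. For nodes $\boldsymbol x_0,\ldots,\boldsymbol x_{N-1}$ it is $\sup_{\|f\|\le1}\left|\int_{[0,1]^s}f(\boldsymbol x)\,d\boldsymbol x-\frac1N\sum_{h=0}^{N-1}f(\boldsymbol x_h)\right|$. Polynomial lattice rule. $\mathbb F_b$ is identified with $\{0,\ldots,b-1\}$ with arithmetic modulo $b$. For a formal Laurent series $\sum_{i=\ell}^\infty w_iX^{-i}\in\mathbb F_b((X^{-1}))$ set $v_n(\sum_{i=\ell}^\infty w_iX^{-i})=\sum_{i=\max(\ell,1)}^n w_ib^{-i}\in[0,1)$. For $0\le h<b^m$, $h=\sum_{i=0}^{m-1}h_ib^i$, put $h(X)=\sum_{i=0}^{m-1}h_iX^i$. The points are $x_{h,j}=v_n\!\left(h(X)q_j(X)/p(X)\right)$, $0\le h<b^m$, $1\le j\le s$, and the rule is the equal-weight quadrature rule with these $N=b^m$ nodes (counted with multiplicity). *)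

theory Defs
  imports
    "HOL-Analysis.Analysis"
    "HOL-Computational_Algebra.Formal_Laurent_Series"
    "Berlekamp_Zassenhaus.Finite_Field"
begin

section \<open>Base \<open>b\<close> digits\<close>

text \<open>\<open>nat_digit b k i\<close> is the digit $\kappa_i$ of $k = \sum_i \kappa_i b^i$.\<close>

definition nat_digit :: "nat \<Rightarrow> nat \<Rightarrow> nat \<Rightarrow> nat" where
  "nat_digit b k i = (k div b ^ i) mod b"

text \<open>\<open>frac_digit b x i\<close>, for $i \ge 1$, is the digit $\xi_i$ of $x = \sum_{i \ge 1} \xi_i b^{-i}
  \in [0,1)$.  The lemmas \<open>frac_digit_less\<close>, \<open>frac_digit_sums\<close> and
  \<open>frac_digit_not_eventually\<close> below show that the closed form gives the expansion in which
  infinitely many digits differ from $b - 1$.\<close>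

definition frac_digit :: "nat \<Rightarrow> real \<Rightarrow> nat \<Rightarrow> nat" where
  "frac_digit b x i = nat \<lfloor>x * real b ^ i\<rfloor> mod b"

lemma nat_digit_less: "b \<ge> 2 \<Longrightarrow> nat_digit b k i < b"
  by (simp add: nat_digit_def)

lemma nat_digit_expansion_aux:
  "k = (\<Sum>i<n. nat_digit b k i * b ^ i) + (k div b ^ n) * b ^ n"
proof (induction n)
  case (Suc n)
  have "(k div b ^ n) = nat_digit b k n + b * (k div b ^ Suc n)"
    by (simp add: nat_digit_def div_mult2_eq mult.commute[of b "b ^ n"])
  then have "(k div b ^ n) * b ^ n
      = nat_digit b k n * b ^ n + (k div b ^ Suc n) * b ^ Suc n"
    by (simp add: algebra_simps)
  with Suc show ?case
    by simp
qed simp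

lemma nat_digit_expansion:
  assumes "k < b ^ n"
  shows "k = (\<Sum>i<n. nat_digit b k i * b ^ i)"
  using nat_digit_expansion_aux[of k b n] assms by simp

lemma frac_digit_less: "b \<ge> 2 \<Longrightarrow> frac_digit b x i < b"
  by (simp add: frac_digit_def)

lemma frac_digit_Suc:
  assumes "b \<ge> 2" "0 \<le> x"
  shows "real (frac_digit b x (Suc n))
    = of_int \<lfloor>x * real b ^ Suc n\<rfloor> - real b * of_int \<lfloor>x * real b ^ n\<rfloor>"
proof -
  let ?y = "\<lfloor>x * real b ^ Suc n\<rfloor>"
  have "x * real b ^ n = (x * real b ^ Suc n) / real_of_int (int b)"
    using assms by simp
  then have *: "?y div int b = \<lfloor>x * real b ^ n\<rfloor>"
    by (metis floor_divide_real_eq_div of_nat_0_le_iff)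
  have "0 \<le> ?y"
    using assms by simp
  then have "int (frac_digit b x (Suc n)) = ?y mod int b"
    by (simp only: frac_digit_def zmod_int int_nat_eq if_True)
  also have "\<dots> = ?y - int b * (?y div int b)"
    by (simp add: minus_mult_div_eq_mod)
  finally show ?thesis
    unfolding * by (metis of_int_diff of_int_mult of_int_of_nat_eq)
qed

lemma frac_digit_partial_sum:
  assumes "b \<ge> 2" "0 \<le> x" "x < 1"
  shows "(\<Sum>i<n. real (frac_digit b x (Suc i)) / real b ^ Suc i)
    = of_int \<lfloor>x * real b ^ n\<rfloor> / real b ^ n"
proof (induction n)
  case 0
  have "\<lfloor>x\<rfloor> = 0" using assms by linarith
  then show ?case by simp
next
  case (Suc n)
  then show ?case
    unfolding sum.lessThan_Suc Suc frac_digit_Suc[OF assms(1,2)]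
    using assms(1) by (simp add: field_simps)
qed

lemma frac_digit_sums:
  assumes "b \<ge> 2" "0 \<le> x" "x < 1"
  shows "(\<lambda>i. real (frac_digit b x (Suc i)) / real b ^ Suc i) sums x"
proof -
  have b: "real b > 1" using assms by simp
  have "(\<lambda>n. x - of_int \<lfloor>x * real b ^ n\<rfloor> / real b ^ n) \<longlonglongrightarrow> 0"
  proof (rule tendsto_sandwich)
    show "\<forall>\<^sub>F n in sequentially. 0 \<le> x - of_int \<lfloor>x * real b ^ n\<rfloor> / real b ^ n"
      using b by (auto simp: field_simps)
    have "x - of_int \<lfloor>x * real b ^ n\<rfloor> / real b ^ n \<le> (1 / real b) ^ n" for n
    proof -
      have "x * real b ^ n \<le> 1 + of_int \<lfloor>x * real b ^ n\<rfloor>" by linarith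
      then have "x \<le> (1 + of_int \<lfloor>x * real b ^ n\<rfloor>) / real b ^ n"
        using b by (subst pos_le_divide_eq) auto
      then show ?thesis by (simp add: add_divide_distrib power_one_over)
    qed
    then show "\<forall>\<^sub>F n in sequentially. x - of_int \<lfloor>x * real b ^ n\<rfloor> / real b ^ n \<le> (1 / real b) ^ n"
      by simp
    show "(\<lambda>n. (1 / real b) ^ n) \<longlonglongrightarrow> 0"
      using b by (intro LIMSEQ_realpow_zero) auto
  qed simp
  from tendsto_diff[OF tendsto_const[of x] this]
  show ?thesis
    unfolding sums_def frac_digit_partial_sum[OF assms] by simp
qed

lemma frac_digit_not_eventually:
  assumes "b \<ge> 2" "0 \<le> x" "x < 1"
  shows "\<exists>\<^sub>F i in sequentially. frac_digit b x i \<noteq> b - 1"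
proof (rule ccontr)
  assume "\<not> ?thesis"
  then obtain n where n: "\<And>i. i \<ge> n \<Longrightarrow> frac_digit b x i = b - 1"
    by (auto simp: frequently_def eventually_sequentially)
  have b: "real b > 1" using assms by simp
  have "(\<lambda>i. real (frac_digit b x (Suc (i + n))) / real b ^ Suc (i + n))
      sums (x - of_int \<lfloor>x * real b ^ n\<rfloor> / real b ^ n)"
    using sums_split_initial_segment[OF frac_digit_sums[OF assms], of n]
    by (simp only: frac_digit_partial_sum[OF assms])
  moreover have "(\<lambda>i. real (frac_digit b x (Suc (i + n))) / real b ^ Suc (i + n))
      = (\<lambda>i. ((real b - 1) / real b ^ Suc n) * (1 / real b) ^ i)"
    using n assms(1) by (auto simp: of_nat_diff power_add field_simps)
  moreover have "(\<lambda>i. ((real b - 1) / real b ^ Suc n) * (1 / real b) ^ i)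
      sums (((real b - 1) / real b ^ Suc n) * (1 / (1 - 1 / real b)))"
    using b by (intro sums_mult geometric_sums) auto
  ultimately have "x - of_int \<lfloor>x * real b ^ n\<rfloor> / real b ^ n
      = ((real b - 1) / real b ^ Suc n) * (1 / (1 - 1 / real b))"
    by (metis sums_unique2)
  also have "\<dots> = 1 / real b ^ n"
    using b by (simp add: field_simps)
  finally have "x * real b ^ n = of_int \<lfloor>x * real b ^ n\<rfloor> + 1"
    using b by (simp add: field_simps)
  then show False
    by linarith
qed

definition digit_supp :: "nat \<Rightarrow> nat \<Rightarrow> nat set" where
  "digit_supp b k = {i. nat_digit b k i \<noteq> 0}"

text \<open>The positions $a_1 > \dots > a_{\#k}$ of the non-zero digits of $k$; in particular
  $\#k$ is the length of this list.\<close>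

definition digit_positions :: "nat \<Rightarrow> nat \<Rightarrow> nat list" where
  "digit_positions b k = rev (sorted_list_of_set (digit_supp b k))"

lemma finite_digit_supp:
  assumes "b \<ge> 2"
  shows "finite (digit_supp b k)"
proof (rule finite_subset)
  show "digit_supp b k \<subseteq> {..<k}"
  proof
    fix i assume "i \<in> digit_supp b k"
    then have "b ^ i \<le> k"
      by (metis (mono_tags) digit_supp_def div_less mem_Collect_eq mod_0 nat_digit_def not_le)
    moreover have "i < b ^ i"
      using assms by (simp add: power_gt_expt)
    ultimately show "i \<in> {..<k}" by simp
  qed
qed simp


section \<open>The Walsh space\<close>

definition wal1 :: "nat \<Rightarrow> nat \<Rightarrow> real \<Rightarrow> complex" where
  "wal1 b k x = exp (2 * of_real pi * \<i> *
     of_nat (\<Sum>i\<in>digit_supp b k. frac_digit b x (Suc i) * nat_digit b k i) / of_nat b)"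

text \<open>Points of $[0,1)^s$ and frequency vectors in $\mathbb{N}_0^s$ are extensional functions
  on the index set \<open>{1..s}\<close>, so that the former lie in the product measure space
  \<open>Pi\<^sub>M {1..s} (\<lambda>_. lborel)\<close>.\<close>

definition unit_box :: "nat \<Rightarrow> (nat \<Rightarrow> real) set" where
  "unit_box s = (\<Pi>\<^sub>E j\<in>{1..s}. {0..<1})"

definition freqs :: "nat \<Rightarrow> (nat \<Rightarrow> nat) set" where
  "freqs s = (\<Pi>\<^sub>E j\<in>{1..s}. UNIV)"

definition wal :: "nat \<Rightarrow> nat \<Rightarrow> (nat \<Rightarrow> nat) \<Rightarrow> (nat \<Rightarrow> real) \<Rightarrow> complex" where
  "wal b s k x = (\<Prod>j\<in>{1..s}. wal1 b (k j) (x j))"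

definition decay1 :: "nat \<Rightarrow> nat \<Rightarrow> nat \<Rightarrow> real" where
  "decay1 b \<alpha> k = 1 / real b ^ (\<Sum>a\<leftarrow>take \<alpha> (digit_positions b k). a + 1)"

definition decay :: "nat \<Rightarrow> nat \<Rightarrow> nat \<Rightarrow> (nat \<Rightarrow> real) \<Rightarrow> (nat \<Rightarrow> nat) \<Rightarrow> real" where
  "decay b \<alpha> s \<gamma> k = (\<Prod>j\<in>{j\<in>{1..s}. k j \<noteq> 0}. \<gamma> j * decay1 b \<alpha> (k j))"

text \<open>Functions are only looked at on \<open>unit_box s\<close>, which differs from $[0,1]^s$ by a null set.\<close>

definition box_integral :: "nat \<Rightarrow> ((nat \<Rightarrow> real) \<Rightarrow> complex) \<Rightarrow> complex" where
  "box_integral s f = set_lebesgue_integral (Pi\<^sub>M {1..s} (\<lambda>_. lborel)) (unit_box s) f"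

definition walsh_coeff :: "nat \<Rightarrow> nat \<Rightarrow> ((nat \<Rightarrow> real) \<Rightarrow> complex) \<Rightarrow> (nat \<Rightarrow> nat) \<Rightarrow> complex" where
  "walsh_coeff b s f k = box_integral s (\<lambda>x. f x * cnj (wal b s k x))"

definition walsh_norm ::
  "nat \<Rightarrow> nat \<Rightarrow> nat \<Rightarrow> (nat \<Rightarrow> real) \<Rightarrow> ((nat \<Rightarrow> real) \<Rightarrow> complex) \<Rightarrow> ereal" where
  "walsh_norm b \<alpha> s \<gamma> f =
     (SUP k\<in>freqs s. ereal (cmod (walsh_coeff b s f k) / decay b \<alpha> s \<gamma> k))"

text \<open>No measurability condition is needed: an absolutely convergent Walsh series is a uniform
  limit of step functions.\<close>

definition walsh_space ::
  "nat \<Rightarrow> nat \<Rightarrow> nat \<Rightarrow> (nat \<Rightarrow> real) \<Rightarrow> ((nat \<Rightarrow> real) \<Rightarrow> complex) set" where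
  "walsh_space b \<alpha> s \<gamma> = {f.
     (\<forall>x\<in>unit_box s.
        (\<lambda>k. cmod (walsh_coeff b s f k * wal b s k x)) summable_on freqs s \<and>
        ((\<lambda>k. walsh_coeff b s f k * wal b s k x) has_sum f x) (freqs s)) \<and>
     walsh_norm b \<alpha> s \<gamma> f < \<infinity>}"

text \<open>The suprema here and in \<open>walsh_norm\<close> are taken in the extended reals, so they are
  meaningful also when the set of values is unbounded.\<close>

definition worst_case_error ::
  "nat \<Rightarrow> nat \<Rightarrow> nat \<Rightarrow> (nat \<Rightarrow> real) \<Rightarrow> nat \<Rightarrow> (nat \<Rightarrow> nat \<Rightarrow> real) \<Rightarrow> ereal" where
  "worst_case_error b \<alpha> s \<gamma> N x =
     (SUP f\<in>{f \<in> walsh_space b \<alpha> s \<gamma>. walsh_norm b \<alpha> s \<gamma> f \<le> 1}.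
        ereal (cmod (box_integral s f - (\<Sum>h<N. f (x h)) / of_nat N)))"

definition walsh_omega :: "nat \<Rightarrow> nat \<Rightarrow> real \<Rightarrow> complex" where
  "walsh_omega b \<alpha> x = (\<Sum>k. of_real (decay1 b \<alpha> (Suc k)) * wal1 b (Suc k) x)"


section \<open>Polynomial lattice rules\<close>

text \<open>Formal Laurent series in $X^{-1}$ are modelled by \<^typ>\<open>'a fls\<close> with the library's
  variable \<open>fls_X\<close> playing the role of $X^{-1}$: \<open>fls_nth w i\<close> is the coefficient $w_i$ of
  $X^{-i}$, and a polynomial embeds by evaluation at \<open>fls_X_inv\<close>.\<close>

definition poly_to_laurent :: "'a::field poly \<Rightarrow> 'a fls" where
  "poly_to_laurent f = poly (map_poly fls_const f) fls_X_inv"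

text \<open>The lower summation limit $\max(\ell,1)$ may be replaced by $1$ because
  coefficients below the order of the series vanish.\<close>

definition laurent_trunc :: "nat \<Rightarrow> 'b::prime_card mod_ring fls \<Rightarrow> real" where
  "laurent_trunc n w =
     (\<Sum>i=1..n. real_of_int (to_int_mod_ring (fls_nth w (int i))) / real CARD('b) ^ i)"

definition digit_poly :: "nat \<Rightarrow> nat \<Rightarrow> 'b::prime_card mod_ring poly" where
  "digit_poly m h = (\<Sum>i<m. Polynomial.monom (of_nat (nat_digit CARD('b) h i)) i)"

definition poly_lattice_point ::
  "nat \<Rightarrow> nat \<Rightarrow> nat \<Rightarrow> (nat \<Rightarrow> 'b::prime_card mod_ring poly) \<Rightarrow> 'b mod_ring poly
    \<Rightarrow> nat \<Rightarrow> nat \<Rightarrow> real" where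
  "poly_lattice_point m n s q p h =
     (\<lambda>j\<in>{1..s}. laurent_trunc n
        (poly_to_laurent (digit_poly m h) * poly_to_laurent (q j) / poly_to_laurent p))"

end

theory Submission
  imports Defs
begin

text \<open>Since the digits of $x_{h,j}$ depend $\mathbb F_b$-linearly on the digits of $h$, the average
  $\sigma(k)$ of $\mathrm{wal}_k$ over the nodes is a product of averages of characters of
  $\mathbb F_b$, so it is $0$ or $1$.  For $f$ in the unit ball the error is
  $-\sum_{k \ne 0} \widehat f_k \sigma(k)$, which is at most $\sum_{k \ne 0} r(k) \sigma(k)$ in
  modulus; as $\sigma \ge 0$, equality holds for $f = \sum_k r(k)\,\mathrm{wal}_k$.  This $f$ equals
  $\prod_j (1 + \gamma_j \omega_\alpha(x_j))$, and it has Walsh coefficients $r(k)$ because the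
  Walsh functions are orthonormal and $\sum_k r(k)$ converges (here $\alpha \ge 2$ is needed).\<close>

section \<open>Summability of the decay function\<close>

text \<open>Convergence is the delicate point. For \<open>\<alpha>\<close> = 1 the (b - 1) b^n
  integers with leading digit at position n all have weight b^-(n+1), so every such block
  contributes (b - 1)/b and the sum diverges, though only linearly in n. Removing the leading digit
  lowers \<open>\<alpha>\<close> by one at the price of a factor b^-(n+1); for
  \<open>\<alpha>\<close> >= 2 a block therefore contributes at most (n + 1) b^-n, which is
  summable. Orthonormality in one variable rests on self-similarity: y -> (d + y)/b prepends the
  digit d, which turns an integral of Walsh functions into a geometric sum times the integral for
  frequencies with one digit less. As Walsh functions are complex-valued, the right-hand side must
  also be shown to be real: it is the sum of the nonnegative numbers r(k) sigma(k) over nonzero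
  k.\<close>

lemma sum_lessThan_mult_block:
  fixes f :: "nat \<Rightarrow> 'a::comm_monoid_add"
  shows "(\<Sum>k<c * N. f k) = (\<Sum>i<c. \<Sum>k<N. f (i * N + k))"
proof -
  have "(\<Sum>k<c * N. f k) = (\<Sum>i<c. sum f {i * N..<i * N + N})"
    by (rule sum.nat_group[symmetric])
  also have "\<dots> = (\<Sum>i<c. \<Sum>k<N. f (i * N + k))"
  proof (rule sum.cong)
    show "sum f {i * N..<i * N + N} = (\<Sum>k<N. f (i * N + k))" for i
      using sum.shift_bounds_nat_ivl[of f 0 "i * N" N] by (simp add: add.commute atLeast0LessThan)
  qed simp
  finally show ?thesis .
qed

lemma nat_digit_block:
  assumes "d < b" "k < b ^ n"
  shows "nat_digit b (d * b ^ n + k) i = (if i < n then nat_digit b k i else if i = n then d else 0)"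
proof -
  have b: "b > 0" using assms by auto
  consider "i < n" | "i = n" | "i > n" by linarith
  then show ?thesis
  proof cases
    case 1
    \<comment> \<open>The factor \<open>b\<close> split off from b^(n-i) makes the added block
      vanish modulo \<open>b\<close>.\<close>
    then obtain j where "n = Suc (i + j)" using less_iff_Suc_add by auto
    then have "d * b ^ n + k = k + (d * b ^ j * b) * b ^ i"
      by (simp add: power_add)
    then have "(d * b ^ n + k) div b ^ i = d * b ^ j * b + k div b ^ i"
      using b by (simp only: div_mult_self1) simp
    then show ?thesis using 1 by (simp add: nat_digit_def)
  next
    case 2
    then show ?thesis using assms b by (simp add: nat_digit_def)
  next
    case 3
    have "d * b ^ n + k < b * b ^ n"
    proof -
      have "d * b ^ n + k < Suc d * b ^ n" using assms by simp
      also have "\<dots> \<le> b * b ^ n" using assms by (intro mult_right_mono) auto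
      finally show ?thesis .
    qed
    also have "\<dots> \<le> b ^ i"
      using 3 b power_increasing[of "Suc n" i b] by simp
    finally show ?thesis using 3 by (simp add: nat_digit_def)
  qed
qed

lemma digit_supp_subset:
  assumes "b \<ge> 2" "k < b ^ n"
  shows "digit_supp b k \<subseteq> {..<n}"
proof
  fix i assume "i \<in> digit_supp b k"
  then have "b ^ i \<le> k"
    by (metis (mono_tags) digit_supp_def div_less mem_Collect_eq mod_0 nat_digit_def not_le)
  also note assms(2)
  finally show "i \<in> {..<n}" using assms(1) by simp
qed

lemma digit_positions_block:
  assumes "b \<ge> 2" "0 < d" "d < b" "k < b ^ n"
  shows "digit_positions b (d * b ^ n + k) = n # digit_positions b k"
proof -
  let ?A = "digit_supp b k"
  have fin: "finite ?A" by (rule finite_digit_supp) fact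
  have sub: "?A \<subseteq> {..<n}" using assms by (intro digit_supp_subset)
  have "digit_supp b (d * b ^ n + k) = insert n ?A"
    using assms(2) sub by (auto simp: digit_supp_def nat_digit_block[OF assms(3,4)])
  moreover have "sorted_list_of_set (set (sorted_list_of_set ?A @ [n])) = sorted_list_of_set ?A @ [n]"
    using fin sub by (intro sorted_list_of_set.idem_if_sorted_distinct) (auto simp: sorted_append)
  ultimately show ?thesis
    using fin by (simp add: digit_positions_def)
qed

text \<open>The leading position \<open>n\<close> uses up one of the \<open>Suc \<alpha>\<close>
  positions that count, leaving \<open>\<alpha>\<close> of them for the lower part \<open>k\<close>.
  The bounds on sums of \<open>decay1\<close> come from this recursion.\<close>

lemma decay1_block:
  assumes "b \<ge> 2" "0 < d" "d < b" "k < b ^ n"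
  shows "decay1 b (Suc \<alpha>) (d * b ^ n + k) = decay1 b \<alpha> k / real b ^ Suc n"
  unfolding decay1_def digit_positions_block[OF assms] by (simp add: power_add)

lemma decay1_zero [simp]: "decay1 b \<alpha> 0 = 1"
  by (simp add: decay1_def digit_positions_def digit_supp_def nat_digit_def)

lemma decay1_pos: "b \<ge> 2 \<Longrightarrow> decay1 b \<alpha> k > 0"
  by (simp add: decay1_def)

text \<open>Split by the digit \<open>d\<close> at position \<open>n\<close>: \<open>d = 0\<close>
  reproduces the shorter sum, and each of the b - 1 other values gives the sum for
  \<open>\<alpha>\<close> divided by b^(n+1). The quotient (b - 1)/b is estimated by 1.\<close>

lemma sum_decay1_Suc:
  assumes "b \<ge> 2"
  shows "(\<Sum>k<b ^ Suc n. decay1 b (Suc \<alpha>) k)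
    \<le> (\<Sum>k<b ^ n. decay1 b (Suc \<alpha>) k) + (\<Sum>k<b ^ n. decay1 b \<alpha> k) / real b ^ n"
proof -
  let ?S = "(\<Sum>k<b ^ n. decay1 b \<alpha> k)"
  have S0: "?S \<ge> 0" using assms by (intro sum_nonneg) (simp add: decay1_pos less_imp_le)
  obtain c where c: "b = Suc c" using assms by (cases b) auto
  have "(\<Sum>k<b ^ Suc n. decay1 b (Suc \<alpha>) k)
      = (\<Sum>d<Suc c. \<Sum>k<b ^ n. decay1 b (Suc \<alpha>) (d * b ^ n + k))"
    by (simp only: power_Suc sum_lessThan_mult_block flip: c)
  also have "\<dots> = (\<Sum>k<b ^ n. decay1 b (Suc \<alpha>) k)
      + (\<Sum>d<c. \<Sum>k<b ^ n. decay1 b (Suc \<alpha>) (Suc d * b ^ n + k))"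
    by (simp only: sum.lessThan_Suc_shift mult_0 add_0)
  also have "(\<Sum>d<c. \<Sum>k<b ^ n. decay1 b (Suc \<alpha>) (Suc d * b ^ n + k)) = (\<Sum>d<c. ?S / real b ^ Suc n)"
    unfolding sum_divide_distrib
    using assms c by (intro sum.cong refl decay1_block) auto
  also have "\<dots> = real c / real b * (?S / real b ^ n)"
    by simp
  also have "\<dots> \<le> 1 * (?S / real b ^ n)"
    using S0 c by (intro mult_right_mono) auto
  finally show ?thesis by simp
qed

text \<open>Each step adds at most 1, simply because \<open>decay1\<close> is at most 1: after
  removal of the leading digit \<open>\<beta>\<close> may be 0, where nothing better holds.\<close>

lemma sum_decay1_le_linear:
  assumes "b \<ge> 2" "\<alpha> \<ge> 1"
  shows "(\<Sum>k<b ^ n. decay1 b \<alpha> k) \<le> real (n + 1)"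
  using assms(2)
proof (induction n arbitrary: \<alpha>)
  case 0
  then show ?case by (simp add: lessThan_Suc)
next
  case (Suc n)
  then obtain \<beta> where \<beta>: "\<alpha> = Suc \<beta>" by (cases \<alpha>) auto
  have "(\<Sum>k<b ^ n. decay1 b \<beta> k) \<le> real b ^ n"
  proof -
    have "(\<Sum>k<b ^ n. decay1 b \<beta> k) \<le> (\<Sum>k<b ^ n. 1)"
      using assms by (intro sum_mono) (simp add: decay1_def)
    then show ?thesis by simp
  qed
  then have "(\<Sum>k<b ^ n. decay1 b \<beta> k) / real b ^ n \<le> 1"
    using assms by simp
  then show ?case
    using sum_decay1_Suc[OF assms(1), of \<beta> n] Suc.IH[OF Suc.prems] by (simp add: \<beta>)
qed

text \<open>The bound is $1 + \sum_{i<n} (i + 1) 2^{-i}$ in closed form.\<close>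

lemma sum_decay1_le_const:
  assumes "b \<ge> 2" "\<alpha> \<ge> 2"
  shows "(\<Sum>k<b ^ n. decay1 b \<alpha> k) \<le> 5 - (2 * real n + 4) / 2 ^ n"
proof (induction n)
  case 0
  then show ?case by (simp add: lessThan_Suc)
next
  case (Suc n)
  obtain \<beta> where \<beta>: "\<alpha> = Suc \<beta>" "\<beta> \<ge> 1" using assms(2) by (cases \<alpha>) auto
  have "(\<Sum>k<b ^ n. decay1 b \<beta> k) / real b ^ n \<le> real (n + 1) / 2 ^ n"
    using assms(1) by (intro frac_le sum_decay1_le_linear power_mono \<beta>(2)) auto
  then have "(\<Sum>k<b ^ Suc n. decay1 b \<alpha> k) \<le> 5 - (2 * real n + 4) / 2 ^ n + real (n + 1) / 2 ^ n"
    using sum_decay1_Suc[OF assms(1), of \<beta> n] Suc by (simp add: \<beta>(1))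
  also have "\<dots> = 5 - (2 * real (Suc n) + 4) / 2 ^ Suc n"
    by (simp add: field_simps)
  finally show ?case .
qed

lemma summable_decay1:
  assumes "b \<ge> 2" "\<alpha> \<ge> 2"
  shows "summable (decay1 b \<alpha>)"
proof (rule bounded_imp_summable)
  fix n
  have "n < b ^ n" using assms by (simp add: power_gt_expt)
  then have "sum (decay1 b \<alpha>) {..n} \<le> sum (decay1 b \<alpha>) {..<b ^ n}"
    using assms by (intro sum_mono2) (auto simp: decay1_pos less_imp_le)
  also have "\<dots> \<le> 5 - (2 * real n + 4) / 2 ^ n" by (rule sum_decay1_le_const) fact+
  also have "\<dots> \<le> 5" by simp
  finally show "sum (decay1 b \<alpha>) {..n} \<le> 5" .
qed (use assms in \<open>simp add: decay1_pos less_imp_le\<close>)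

section \<open>Roots of unity and Walsh functions\<close>

definition unity_root :: "nat \<Rightarrow> nat \<Rightarrow> complex" where
  "unity_root b t = exp (2 * of_real pi * \<i> * of_nat t / of_nat b)"

lemma unity_root_0 [simp]: "unity_root b 0 = 1"
  by (simp add: unity_root_def)

lemma unity_root_add: "unity_root b (t + u) = unity_root b t * unity_root b u"
  by (simp add: unity_root_def algebra_simps add_divide_distrib flip: exp_add)

lemma unity_root_sum: "unity_root b (\<Sum>i\<in>A. f i) = (\<Prod>i\<in>A. unity_root b (f i))"
  by (induction A rule: infinite_finite_induct) (simp_all add: unity_root_add)

lemma unity_root_mult: "unity_root b (t * u) = unity_root b t ^ u"
  by (induction u) (simp_all add: unity_root_add)

lemma norm_unity_root [simp]: "norm (unity_root b t) = 1"
  by (simp add: unity_root_def norm_exp_eq_Re)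

lemma unity_root_period [simp]: "b > 0 \<Longrightarrow> unity_root b b = 1"
  by (simp add: unity_root_def)

lemma unity_root_mod: "b > 0 \<Longrightarrow> unity_root b (t mod b) = unity_root b t"
proof -
  assume b: "b > 0"
  have "unity_root b t = unity_root b (t mod b + b * (t div b))" by simp
  also have "\<dots> = unity_root b (t mod b)"
    unfolding unity_root_add unity_root_mult using b by simp
  finally show ?thesis by simp
qed

lemma unity_root_inj:
  assumes "t < b" "u < b" "unity_root b t = unity_root b u"
  shows "t = u"
proof -
  have b: "b > 0" using assms by simp
  obtain z :: int where "2 * of_real pi * \<i> * of_nat t / of_nat b
      = 2 * of_real pi * \<i> * of_nat u / of_nat b + of_int (2 * z) * of_real pi * \<i>"
    using assms(3) unfolding unity_root_def exp_eq by (auto simp: mult_ac)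
  then have "(2 * of_real pi * \<i>) * of_nat t
      = (2 * of_real pi * \<i>) * (of_nat u + of_int z * of_nat b :: complex)"
    using b by (simp add: field_simps)
  then have "of_nat t = (of_nat u + of_int z * of_nat b :: complex)"
    by (subst (asm) mult_left_cancel) auto
  then have "(of_int (int t) :: complex) = of_int (int u + z * int b)"
    by simp
  then have "int t = int u + z * int b"
    by (simp only: of_int_eq_iff)
  then have "int t mod int b = int u mod int b" by simp
  then show ?thesis using assms by simp
qed

text \<open>The geometric sum has numerator z^b - 1 = 0 unless \<open>z = 1\<close>. This dichotomy
  yields both the orthogonality of the Walsh functions and the node averages.\<close>

lemma sum_powers_of_unity:
  fixes z :: complex
  assumes "z ^ b = 1"
  shows "(\<Sum>d<b. z ^ d) = (if z = 1 then of_nat b else 0)"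
  using assms by (simp add: geometric_sum)

text \<open>Zero digits contribute the factor 1, so any range that covers the support
  serves.\<close>

lemma wal1_eq_prod:
  assumes "b \<ge> 2" "k < b ^ n"
  shows "wal1 b k x = (\<Prod>i<n. unity_root b (frac_digit b x (Suc i) * nat_digit b k i))"
proof -
  have "(\<Sum>i\<in>digit_supp b k. frac_digit b x (Suc i) * nat_digit b k i)
      = (\<Sum>i<n. frac_digit b x (Suc i) * nat_digit b k i)"
    by (rule sum.mono_neutral_left) (use digit_supp_subset[OF assms] in \<open>auto simp: digit_supp_def\<close>)
  then show ?thesis
    by (simp only: wal1_def unity_root_sum flip: unity_root_def)
qed

lemma norm_wal1 [simp]: "norm (wal1 b k x) = 1"
  unfolding wal1_def unity_root_def[symmetric] by simp

lemma wal1_zero [simp]: "wal1 b 0 x = 1"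
  by (simp add: wal1_def digit_supp_def nat_digit_def)

lemma measurable_frac_digit [measurable]:
  "(\<lambda>x. frac_digit b x i) \<in> borel \<rightarrow>\<^sub>M count_space UNIV"
  unfolding frac_digit_def by measurable

lemma measurable_wal1 [measurable]: "wal1 b k \<in> borel_measurable borel"
  unfolding wal1_def by measurable

lemma measurable_cnj [measurable]: "cnj \<in> borel_measurable borel"
  by (intro borel_measurable_continuous_onI continuous_intros)

text \<open>Dividing by \<open>b\<close> moves the digits of \<open>y\<close> one place to the right
  and puts \<open>d\<close> in front: the integer d b^(i+1) is divisible by \<open>b\<close> and
  disappears from the later digits.\<close>

lemma frac_digit_shift:
  assumes "b \<ge> 2" "d < b" "0 \<le> y" "y < 1"
  shows "frac_digit b ((real d + y) / real b) (Suc 0) = d"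
    and "frac_digit b ((real d + y) / real b) (Suc (Suc i)) = frac_digit b y (Suc i)"
proof -
  have fl: "\<lfloor>real d + y\<rfloor> = int d" using assms by linarith
  then show "frac_digit b ((real d + y) / real b) (Suc 0) = d"
    using assms by (simp add: frac_digit_def)
  have "(real d + y) / real b * real b ^ Suc (Suc i) = y * real b ^ Suc i + of_int (int (d * b ^ Suc i))"
    using assms by (simp add: field_simps)
  then have "\<lfloor>(real d + y) / real b * real b ^ Suc (Suc i)\<rfloor> = \<lfloor>y * real b ^ Suc i\<rfloor> + int (d * b ^ Suc i)"
    by (simp only: floor_add_int)
  moreover have "0 \<le> \<lfloor>y * real b ^ Suc i\<rfloor>" using assms by simp
  ultimately show "frac_digit b ((real d + y) / real b) (Suc (Suc i)) = frac_digit b y (Suc i)"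
    unfolding frac_digit_def
    by (simp only: nat_add_distrib of_nat_0_le_iff nat_int) (simp add: mult.left_commute[of d b])
qed

lemma wal1_shift:
  assumes "b \<ge> 2" "d < b" "0 \<le> y" "y < 1"
  shows "wal1 b k ((real d + y) / real b) = unity_root b (k mod b) ^ d * wal1 b (k div b) y"
proof -
  have k: "k < b ^ k" using assms by (simp add: power_gt_expt)
  have dig: "nat_digit b k (Suc i) = nat_digit b (k div b) i" for i
    by (simp add: nat_digit_def div_mult2_eq)
  \<comment> \<open>\<open>Suc k\<close> factors: one for the digit \<open>d\<close>, and the other
    \<open>k\<close> are enough for \<open>k div b\<close>.\<close>
  have "wal1 b k ((real d + y) / real b)
     = (\<Prod>i<Suc k. unity_root b (frac_digit b ((real d + y) / real b) (Suc i) * nat_digit b k i))"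
    using assms k by (intro wal1_eq_prod) (auto intro: less_le_trans)
  also have "\<dots> = unity_root b (k mod b) ^ d *
      (\<Prod>i<k. unity_root b (frac_digit b y (Suc i) * nat_digit b (k div b) i))"
    by (simp only: prod.lessThan_Suc_shift frac_digit_shift[OF assms] dig) (simp add: nat_digit_def mult.commute[of d] unity_root_mult)
  also have "(\<Prod>i<k. unity_root b (frac_digit b y (Suc i) * nat_digit b (k div b) i)) = wal1 b (k div b) y"
    using assms k by (intro wal1_eq_prod[symmetric]) (auto intro: le_less_trans[OF div_le_dividend])
  finally show ?thesis .
qed

section \<open>Integrals over the unit interval and orthonormality in one variable\<close>

definition unit_integral :: "(real \<Rightarrow> complex) \<Rightarrow> complex" where
  "unit_integral g = (LINT y:{0..<1}|lborel. g y)"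

lemma set_integrable_bounded_interval:
  fixes g :: "real \<Rightarrow> complex"
  assumes [measurable]: "g \<in> borel_measurable borel" and "\<And>x. norm (g x) \<le> C"
  shows "set_integrable lborel {u..<v} g"
  unfolding set_integrable_def
proof (rule Bochner_Integration.integrable_bound)
  show "integrable lborel (\<lambda>x. indicator {u..<v} x *\<^sub>R C)"
    by (cases "u \<le> v") (auto intro!: integrable_scaleR_left integrable_real_indicator)
  have "norm (g x) \<le> \<bar>C\<bar>" for x
    using assms(2)[of x] by linarith
  then show "AE x in lborel. norm (indicator {u..<v} x *\<^sub>R g x) \<le> norm (indicator {u..<v} x *\<^sub>R C)"
    by (auto simp: indicator_def)
  show "(\<lambda>x. indicator {u..<v} x *\<^sub>R g x) \<in> borel_measurable lborel"
    by (intro borel_measurable_scaleR borel_measurable_indicator) (auto simp: assms(1))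
qed

text \<open>The unit interval is cut into \<open>b\<close> equal pieces, each rescaled to full
  length by x = (d + y)/b. Boundedness makes every piece integrable, so the integral distributes
  over the sum of indicators.\<close>

lemma unit_integral_split:
  fixes g :: "real \<Rightarrow> complex"
  assumes "b > 0" and [measurable]: "g \<in> borel_measurable borel" and "\<And>x. norm (g x) \<le> C"
  shows "unit_integral g = (\<Sum>d<b. unit_integral (\<lambda>y. g ((real d + y) / real b))) / of_nat b"
proof -
  let ?I = "\<lambda>d. {real d / real b..<(real d + 1) / real b}"
  have ind: "(indicator {0..<1} x :: real) = (\<Sum>d<b. indicator (?I d) x)" for x :: real
  proof -
    \<comment> \<open>The pieces are level sets of the floor of x b, hence disjoint.\<close>
    have mem: "x \<in> ?I d \<longleftrightarrow> \<lfloor>x * real b\<rfloor> = int d" for d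
      using assms(1) by (auto simp: floor_eq_iff field_simps)
    show ?thesis
    proof (cases "x \<in> {0..<1}")
      case True
      let ?d = "nat \<lfloor>x * real b\<rfloor>"
      have "x * real b < real b" using True assms(1) by simp
      then have d: "\<lfloor>x * real b\<rfloor> = int ?d" "?d < b"
        using True assms(1) by (auto simp: nat_less_iff floor_less_iff)
      have "(\<Sum>d<b. indicator (?I d) x) = (\<Sum>d<b. if d = ?d then 1 else (0::real))"
        using d(1) by (intro sum.cong refl) (simp only: indicator_def mem, auto)
      then show ?thesis using True d(2) by simp
    next
      case False
      have "x \<notin> ?I d" if "d < b" for d
      proof
        assume "x \<in> ?I d"
        moreover have "0 \<le> real d / real b" by simp
        moreover have "(real d + 1) / real b \<le> 1" using that by simp
        ultimately have "0 \<le> x \<and> x < 1" by (meson atLeastLessThan_iff order_trans less_le_trans)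
        with False show False by simp
      qed
      then have "(\<Sum>d<b. indicator (?I d) x) = (\<Sum>d<b. 0 :: real)"
        by (intro sum.cong refl) (simp only: indicator_def lessThan_iff, simp)
      then show ?thesis using False by (simp add: indicator_def)
    qed
  qed
  have "unit_integral g = (LINT x|lborel. (\<Sum>d<b. indicator (?I d) x *\<^sub>R g x))"
    unfolding unit_integral_def set_lebesgue_integral_def ind by (simp add: scaleR_sum_left)
  also have "\<dots> = (\<Sum>d<b. (LINT x|lborel. indicator (?I d) x *\<^sub>R g x))"
    by (intro Bochner_Integration.integral_sum)
       (use set_integrable_bounded_interval[OF assms(2,3)] in \<open>auto simp: set_integrable_def\<close>)
  also have "\<dots> = (\<Sum>d<b. unit_integral (\<lambda>y. g ((real d + y) / real b)) / of_nat b)"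
  proof (intro sum.cong refl)
    fix d
    have "(LINT x|lborel. indicator (?I d) x *\<^sub>R g x)
        = \<bar>1 / real b\<bar> *\<^sub>R (LINT y|lborel. indicator (?I d) (real d / real b + 1 / real b * y) *\<^sub>R
            g (real d / real b + 1 / real b * y))"
      using assms(1) by (intro lborel_integral_real_affine) auto
    also have "(\<lambda>y. indicator (?I d) (real d / real b + 1 / real b * y) *\<^sub>R
            g (real d / real b + 1 / real b * y)) = (\<lambda>y. indicator {0..<1} y *\<^sub>R g ((real d + y) / real b))"
      using assms(1) by (auto simp: indicator_def field_simps fun_eq_iff)
    finally show "(LINT x|lborel. indicator (?I d) x *\<^sub>R g x)
        = unit_integral (\<lambda>y. g ((real d + y) / real b)) / of_nat b"
      by (simp add: unit_integral_def set_lebesgue_integral_def scaleR_conv_of_real)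
  qed
  finally show ?thesis by (simp add: sum_divide_distrib)
qed

lemma unit_integral_cong:
  "(\<And>y. 0 \<le> y \<Longrightarrow> y < 1 \<Longrightarrow> f y = g y) \<Longrightarrow> unit_integral f = unit_integral g"
  unfolding unit_integral_def by (rule set_lebesgue_integral_cong) auto

lemma unit_integral_cmult: "unit_integral (\<lambda>y. c * f y) = c * unit_integral f"
  by (simp add: unit_integral_def)

lemma unit_integral_one [simp]: "unit_integral (\<lambda>_. 1) = 1"
  by (simp add: unit_integral_def set_lebesgue_integral_def)

text \<open>Stripping the lowest digit of both frequencies multiplies the integral by the average of
  \<open>z ^ d\<close> over \<open>d < b\<close>, which is 1 or 0 according as these digits agree or
  not. The induction ends at the pair (0, 0).\<close>

lemma unit_integral_wal1:
  assumes "b \<ge> 2"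
  shows "unit_integral (\<lambda>y. wal1 b k y * cnj (wal1 b l y)) = (if k = l then 1 else 0)"
proof (induction "k + l" arbitrary: k l rule: less_induct)
  case less
  show ?case
  proof (cases "k = 0 \<and> l = 0")
    case False
    let ?F = "\<lambda>k l. unit_integral (\<lambda>y. wal1 b k y * cnj (wal1 b l y))"
    define z where "z = unity_root b (k mod b) * cnj (unity_root b (l mod b))"
    have zb: "z ^ b = 1"
      unfolding z_def power_mult_distrib using assms
      by (simp flip: unity_root_mult complex_cnj_power) (simp add: mult.commute[of _ b] unity_root_mult)
    have z1: "z = 1 \<longleftrightarrow> k mod b = l mod b"
    proof
      assume "z = 1"
      \<comment> \<open>Conjugation inverts a number of modulus 1.\<close>
      have "unity_root b (k mod b) = z * unity_root b (l mod b)"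
        by (simp add: z_def mult.assoc complex_norm_square[symmetric] mult.commute[of "cnj _"])
      with \<open>z = 1\<close> show "k mod b = l mod b"
        using assms by (intro unity_root_inj[of _ b]) auto
    qed (simp add: z_def complex_norm_square[symmetric])
    have "?F k l = (\<Sum>d<b. unit_integral (\<lambda>y. wal1 b k ((real d + y) / real b) *
        cnj (wal1 b l ((real d + y) / real b)))) / of_nat b"
      using assms by (intro unit_integral_split[where C = 1]) (auto simp: norm_mult)
    also have "(\<Sum>d<b. unit_integral (\<lambda>y. wal1 b k ((real d + y) / real b) *
        cnj (wal1 b l ((real d + y) / real b)))) = (\<Sum>d<b. z ^ d * ?F (k div b) (l div b))"
    proof (intro sum.cong refl)
      fix d assume d: "d \<in> {..<b}"
      have "unit_integral (\<lambda>y. wal1 b k ((real d + y) / real b) * cnj (wal1 b l ((real d + y) / real b)))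
        = unit_integral (\<lambda>y. z ^ d * (wal1 b (k div b) y * cnj (wal1 b (l div b) y)))"
        using assms d by (intro unit_integral_cong) (simp add: wal1_shift z_def power_mult_distrib)
      then show "unit_integral (\<lambda>y. wal1 b k ((real d + y) / real b) * cnj (wal1 b l ((real d + y) / real b)))
         = z ^ d * ?F (k div b) (l div b)"
        by (simp only: unit_integral_cmult)
    qed
    also have "\<dots> = (\<Sum>d<b. z ^ d) * ?F (k div b) (l div b)"
      by (simp add: sum_distrib_right)
    also have "(\<Sum>d<b. z ^ d) = (if k mod b = l mod b then of_nat b else 0)"
      by (simp add: sum_powers_of_unity[OF zb] z1)
    also have "?F (k div b) (l div b) = (if k div b = l div b then 1 else 0)"
    proof (rule less)
      have "k div b \<le> k" "l div b \<le> l" by simp_all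
      \<comment> \<open>A frequency shrinks under \<open>div b\<close> unless it is 0, and at least
        one of the two is not 0.\<close>
      moreover have "k div b < k \<or> l div b < l" using False assms by auto
      ultimately show "k div b + l div b < k + l" by linarith
    qed
    finally have "?F k l = (if k mod b = l mod b \<and> k div b = l div b then 1 else 0)"
      using assms by simp
    also have "k mod b = l mod b \<and> k div b = l div b \<longleftrightarrow> k = l"
      by (metis div_mult_mod_eq)
    finally show ?thesis .
  qed auto
qed

section \<open>The product decay function\<close>

text \<open>At frequency 0 the value is 1 instead of \<open>g * decay1 b \<alpha> 0 = g\<close>. The
  vector weight then is a product over all coordinates, as the factorization of sums
  requires.\<close>

definition decay_factor :: "nat \<Rightarrow> nat \<Rightarrow> real \<Rightarrow> nat \<Rightarrow> real" where
  "decay_factor b \<alpha> g k = (if k = 0 then 1 else g * decay1 b \<alpha> k)"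

lemma decay_eq_prod: "decay b \<alpha> s \<gamma> k = (\<Prod>j\<in>{1..s}. decay_factor b \<alpha> (\<gamma> j) (k j))"
  unfolding decay_def decay_factor_def by (rule prod.mono_neutral_cong_left) auto

lemma decay_factor_summable:
  assumes "b \<ge> 2" "\<alpha> \<ge> 2" "g > 0"
  shows "decay_factor b \<alpha> g summable_on UNIV"
proof (rule summable_on_comparison_test)
  \<comment> \<open>The constant \<open>1 + g\<close> covers both the value 1 at frequency 0 and the
    factor \<open>g\<close> elsewhere.\<close>
  show "(\<lambda>k. (1 + g) * decay1 b \<alpha> k) summable_on UNIV"
    using assms by (intro summable_on_cmult_right summable_nonneg_imp_summable_on summable_decay1)
      (auto simp: decay1_pos less_imp_le)
qed (use assms in \<open>auto simp: decay_factor_def decay1_pos less_imp_le\<close>)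

lemma norm_wal [simp]: "norm (wal b s k x) = 1"
  unfolding wal_def prod_norm[symmetric] by simp

lemma summable_on_prod_freqs:
  fixes f :: "nat \<Rightarrow> nat \<Rightarrow> real"
  assumes "\<And>j. j \<in> {1..s} \<Longrightarrow> f j summable_on UNIV"
  shows "(\<lambda>k. \<Prod>j\<in>{1..s}. f j (k j)) summable_on freqs s"
proof -
  \<comment> \<open>The product theorem over \<open>PiE\<close> is stated for this notion of
    absolute summability, hence the translation there and back.\<close>
  have "Infinite_Set_Sum.abs_summable_on (f j) UNIV" if "j \<in> {1..s}" for j
    unfolding abs_summable_equivalent[symmetric]
    using assms[OF that] summable_on_iff_abs_summable_on_real[of "f j" UNIV] by blast
  then have "Infinite_Set_Sum.abs_summable_on (\<lambda>k. \<Prod>j\<in>{1..s}. f j (k j)) (freqs s)"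
    unfolding freqs_def by (intro abs_summable_on_prod_PiE) auto
  then have "(\<lambda>k. norm (\<Prod>j\<in>{1..s}. f j (k j))) summable_on freqs s"
    by (simp only: abs_summable_equivalent)
  then show ?thesis by (rule abs_summable_summable)
qed

lemma decay_summable:
  assumes "b \<ge> 2" "\<alpha> \<ge> 2" "\<And>j. j \<in> {1..s} \<Longrightarrow> \<gamma> j > 0"
  shows "decay b \<alpha> s \<gamma> summable_on freqs s"
  unfolding decay_eq_prod using assms
  by (intro summable_on_prod_freqs decay_factor_summable) auto

lemma decay_pos:
  assumes "b \<ge> 2" "\<And>j. j \<in> {1..s} \<Longrightarrow> \<gamma> j > 0"
  shows "decay b \<alpha> s \<gamma> k > 0"
  unfolding decay_def using assms by (intro prod_pos) (auto simp: decay1_pos)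

text \<open>\<open>walsh_omega\<close> is an ordered series starting at frequency 1, while products
  are multiplied out as unordered sums. Absolute convergence identifies the two, and the summand 1
  is the term at frequency 0.\<close>

lemma decay_factor_wal1_sum:
  assumes "b \<ge> 2" "\<alpha> \<ge> 2" "g > 0"
  shows "(\<lambda>k. norm (of_real (decay_factor b \<alpha> g k) * wal1 b k x)) summable_on UNIV"
    and "(\<Sum>\<^sub>\<infinity>k. of_real (decay_factor b \<alpha> g k) * wal1 b k x) = 1 + of_real g * walsh_omega b \<alpha> x"
proof -
  let ?f = "\<lambda>k. of_real (decay_factor b \<alpha> g k) * wal1 b k x"
  have nn: "decay_factor b \<alpha> g k \<ge> 0" for k
    using assms by (auto simp: decay_factor_def decay1_pos less_imp_le)
  show abs: "(\<lambda>k. norm (?f k)) summable_on UNIV"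
    using decay_factor_summable[OF assms] by (simp add: norm_mult nn)
  have "(?f has_sum (\<Sum>\<^sub>\<infinity>k. ?f k)) UNIV"
    by (rule has_sum_infsum[OF abs_summable_summable[OF abs]])
  then have "?f sums (\<Sum>\<^sub>\<infinity>k. ?f k)"
    by (rule has_sum_imp_sums)
  then have "(\<lambda>k. ?f (Suc k)) sums ((\<Sum>\<^sub>\<infinity>k. ?f k) - 1)"
    by (subst sums_Suc_iff) (simp add: decay_factor_def)
  moreover have "(\<lambda>k. ?f (Suc k)) sums (of_real g * walsh_omega b \<alpha> x)"
  proof -
    have "summable (\<lambda>k. norm (of_real (decay1 b \<alpha> (Suc k)) * wal1 b (Suc k) x))"
      using summable_decay1[OF assms(1,2)] assms(1)
      by (simp add: norm_mult summable_Suc_iff decay1_pos less_imp_le)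
    then have "(\<lambda>k. of_real (decay1 b \<alpha> (Suc k)) * wal1 b (Suc k) x) sums walsh_omega b \<alpha> x"
      unfolding walsh_omega_def by (rule summable_sums[OF summable_norm_cancel])
    from sums_mult[OF this, of "of_real g"] show ?thesis
      by (simp add: decay_factor_def mult.assoc)
  qed
  ultimately have "(\<Sum>\<^sub>\<infinity>k. ?f k) - 1 = of_real g * walsh_omega b \<alpha> x"
    by (rule sums_unique2)
  then show "(\<Sum>\<^sub>\<infinity>k. ?f k) = 1 + of_real g * walsh_omega b \<alpha> x"
    by (simp add: algebra_simps)
qed

text \<open>Multiplying out \<open>s\<close> absolutely convergent one-dimensional series gives one
  term for every choice of (k_1, ..., k_s), that is, for every element of
  \<open>freqs s\<close>.\<close>

lemma decay_wal_has_sum: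
  assumes "b \<ge> 2" "\<alpha> \<ge> 2" "\<And>j. j \<in> {1..s} \<Longrightarrow> \<gamma> j > 0"
  shows "((\<lambda>k. of_real (decay b \<alpha> s \<gamma> k) * wal b s k x) has_sum
    (\<Prod>j\<in>{1..s}. 1 + of_real (\<gamma> j) * walsh_omega b \<alpha> (x j))) (freqs s)"
proof -
  have "(\<Prod>j\<in>{1..s}. 1 + of_real (\<gamma> j) * walsh_omega b \<alpha> (x j))
      = (\<Prod>j\<in>{1..s}. \<Sum>\<^sub>\<infinity>k. of_real (decay_factor b \<alpha> (\<gamma> j) k) * wal1 b k (x j))"
    using assms by (intro prod.cong refl decay_factor_wal1_sum(2)[symmetric]) auto
  also have "\<dots> = (\<Sum>\<^sub>\<infinity>k\<in>freqs s. \<Prod>j\<in>{1..s}. of_real (decay_factor b \<alpha> (\<gamma> j) (k j)) * wal1 b (k j) (x j))"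
    unfolding freqs_def using assms decay_factor_wal1_sum(1)
    by (intro infsum_prod_PiE_abs[symmetric]) auto
  also have "\<dots> = (\<Sum>\<^sub>\<infinity>k\<in>freqs s. of_real (decay b \<alpha> s \<gamma> k) * wal b s k x)"
    by (simp add: decay_eq_prod wal_def prod.distrib)
  also have "((\<lambda>k. of_real (decay b \<alpha> s \<gamma> k) * wal b s k x) has_sum \<dots>) (freqs s)"
  proof (rule has_sum_infsum, rule abs_summable_summable)
    have "decay b \<alpha> s \<gamma> k \<ge> 0" for k
      by (rule less_imp_le[OF decay_pos[OF assms(1)]]) (rule assms(3))
    moreover have "decay b \<alpha> s \<gamma> summable_on freqs s"
      using assms by (rule decay_summable)
    ultimately show "(\<lambda>k. norm (of_real (decay b \<alpha> s \<gamma> k) * wal b s k x)) summable_on freqs s"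
      by (simp add: norm_mult)
  qed
  finally show ?thesis .
qed

section \<open>Walsh coefficients on the unit box\<close>

text \<open>Enumerating \<open>A\<close> reduces the exchange to the theorem for sequences. The
  bound \<open>c i * G x\<close> supplies both summability conditions: pointwise in
  \<open>x\<close>, and for the integrals of the norms.\<close>

lemma integral_infsum_dominated:
  fixes f :: "'i \<Rightarrow> 'a \<Rightarrow> complex"
  assumes "countable A" "infinite A" and f: "\<And>i. i \<in> A \<Longrightarrow> integrable M (f i)"
    and G: "integrable M G" "\<And>x. G x \<ge> 0"
    and c: "c summable_on A"
    and bound: "\<And>i x. i \<in> A \<Longrightarrow> x \<in> space M \<Longrightarrow> norm (f i x) \<le> c i * G x"
  shows "(LINT x|M. (\<Sum>\<^sub>\<infinity>i\<in>A. f i x)) = (\<Sum>\<^sub>\<infinity>i\<in>A. integral\<^sup>L M (f i))"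
proof -
  define e where "e = from_nat_into A"
  have e: "bij_betw e UNIV A"
    unfolding e_def by (rule bij_betw_from_nat_into) fact+
  then have eA: "e n \<in> A" for n by (auto simp: bij_betw_def)
  \<comment> \<open>Absolute summability allows the unordered sum to be replaced by the ordered
    series along the enumeration.\<close>
  have reindex: "(\<Sum>\<^sub>\<infinity>i\<in>A. g i) = (\<Sum>n. g (e n))"
    if "(\<lambda>n. norm (g (e n))) summable_on UNIV" for g :: "'i \<Rightarrow> complex"
  proof -
    have "((\<lambda>n. g (e n)) has_sum (\<Sum>\<^sub>\<infinity>n. g (e n))) UNIV"
      by (rule has_sum_infsum[OF abs_summable_summable[OF that]])
    from has_sum_imp_sums[OF this] have "(\<Sum>n. g (e n)) = (\<Sum>\<^sub>\<infinity>n. g (e n))"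
      by (rule sums_unique[symmetric])
    also have "\<dots> = (\<Sum>\<^sub>\<infinity>i\<in>A. g i)"
      by (rule infsum_reindex_bij_betw[OF e])
    finally show ?thesis ..
  qed
  have ce: "(\<lambda>n. c (e n)) summable_on UNIV"
    using c summable_on_reindex_bij_betw[OF e, of c] by simp
  have 1: "(\<lambda>n. norm (f (e n) x)) summable_on UNIV" if "x \<in> space M" for x
    by (rule Infinite_Sum.abs_summable_on_comparison_test'[OF summable_on_cmult_left[OF ce, of "G x"]])
       (use bound eA that in auto)
  have int_bound: "(LINT x|M. norm (f (e n) x)) \<le> c (e n) * integral\<^sup>L M G" for n
  proof -
    have "(LINT x|M. norm (f (e n) x)) \<le> (LINT x|M. c (e n) * G x)"
      using f bound eA G by (intro integral_mono) auto
    then show ?thesis by simp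
  qed
  have 2: "(\<lambda>n. LINT x|M. norm (f (e n) x)) summable_on UNIV"
    by (rule summable_on_comparison_test[OF summable_on_cmult_left[OF ce, of "integral\<^sup>L M G"]])
       (use int_bound in auto)
  have "(LINT x|M. (\<Sum>\<^sub>\<infinity>i\<in>A. f i x)) = (LINT x|M. (\<Sum>n. f (e n) x))"
    by (intro Bochner_Integration.integral_cong refl reindex 1)
  also have "\<dots> = (\<Sum>n. integral\<^sup>L M (f (e n)))"
    by (intro integral_suminf AE_I2 summable_on_imp_summable 1 2 f eA)
  also have "\<dots> = (\<Sum>\<^sub>\<infinity>i\<in>A. integral\<^sup>L M (f i))"
  proof (rule reindex[symmetric])
    show "(\<lambda>n. norm (integral\<^sup>L M (f (e n)))) summable_on UNIV"
      by (rule Infinite_Sum.abs_summable_on_comparison_test'[OF 2]) simp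
  qed
  finally show ?thesis .
qed

section \<open>Integration over the unit box and orthonormality in several variables\<close>

interpretation lborel_product: product_sigma_finite "\<lambda>_ :: nat. lborel :: real measure"
  by standard

text \<open>Elements of \<open>unit_box s\<close> are extensional, so the coordinates in
  \<open>{1..s}\<close> decide membership only for points of the measure space.\<close>

lemma indicator_unit_box:
  assumes "x \<in> space (Pi\<^sub>M {1..s} (\<lambda>_. lborel :: real measure))"
  shows "(indicator (unit_box s) x :: real) = (\<Prod>j\<in>{1..s}. indicator {0..<1} (x j))"
proof (cases "x \<in> unit_box s")
  case True
  then show ?thesis by (simp add: unit_box_def PiE_def Pi_def)
next
  case False
  then obtain j where j: "j \<in> {1..s}" "x j \<notin> {0..<1}"
    using assms by (auto simp: unit_box_def space_PiM PiE_def Pi_def)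
  then have "(\<Prod>j\<in>{1..s}. indicator {0..<1} (x j) :: real) = 0"
    by (intro prod_zero bexI[of _ j]) auto
  then show ?thesis using False by simp
qed

lemma box_integral_prod:
  fixes g :: "nat \<Rightarrow> real \<Rightarrow> complex"
  assumes "\<And>j. j \<in> {1..s} \<Longrightarrow> set_integrable lborel {0..<1} (g j)"
  shows "set_integrable (Pi\<^sub>M {1..s} (\<lambda>_. lborel)) (unit_box s) (\<lambda>x. \<Prod>j\<in>{1..s}. g j (x j))"
    and "box_integral s (\<lambda>x. \<Prod>j\<in>{1..s}. g j (x j)) = (\<Prod>j\<in>{1..s}. unit_integral (g j))"
proof -
  let ?M = "Pi\<^sub>M {1..s} (\<lambda>_. lborel :: real measure)"
  let ?h = "\<lambda>j y. indicator {0..<1} y *\<^sub>R g j y"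
  have eq: "indicator (unit_box s) x *\<^sub>R (\<Prod>j\<in>{1..s}. g j (x j)) = (\<Prod>j\<in>{1..s}. ?h j (x j))"
    if "x \<in> space ?M" for x
    using indicator_unit_box[OF that] by (simp add: scaleR_conv_of_real prod.distrib)
  have h: "integrable lborel (?h j)" if "j \<in> {1..s}" for j
    using assms[OF that] by (simp add: set_integrable_def)
  have "integrable ?M (\<lambda>x. \<Prod>j\<in>{1..s}. ?h j (x j))"
    by (intro lborel_product.product_integrable_prod h) simp
  then show "set_integrable ?M (unit_box s) (\<lambda>x. \<Prod>j\<in>{1..s}. g j (x j))"
    unfolding set_integrable_def by (subst Bochner_Integration.integrable_cong[OF refl eq])
  have "box_integral s (\<lambda>x. \<Prod>j\<in>{1..s}. g j (x j)) = (LINT x|?M. (\<Prod>j\<in>{1..s}. ?h j (x j)))"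
    unfolding box_integral_def set_lebesgue_integral_def
    by (rule Bochner_Integration.integral_cong[OF refl eq])
  also have "\<dots> = (\<Prod>j\<in>{1..s}. unit_integral (g j))"
    unfolding unit_integral_def set_lebesgue_integral_def
    by (intro lborel_product.product_integral_prod h) simp
  finally show "box_integral s (\<lambda>x. \<Prod>j\<in>{1..s}. g j (x j)) = (\<Prod>j\<in>{1..s}. unit_integral (g j))" .
qed

lemma wal1_mult_cnj_integrable: "set_integrable lborel {0..<1} (\<lambda>y. wal1 b k y * cnj (wal1 b l y))"
  by (rule set_integrable_bounded_interval[where C = 1]) (auto simp: norm_mult)

lemma wal_mult_cnj_eq_prod:
  "wal b s k x * cnj (wal b s l x) = (\<Prod>j\<in>{1..s}. wal1 b (k j) (x j) * cnj (wal1 b (l j) (x j)))"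
  by (simp add: wal_def prod.distrib)

lemma box_integral_wal:
  assumes "b \<ge> 2" "k \<in> freqs s" "l \<in> freqs s"
  shows "box_integral s (\<lambda>x. wal b s k x * cnj (wal b s l x)) = (if k = l then 1 else 0)"
proof -
  have "box_integral s (\<lambda>x. wal b s k x * cnj (wal b s l x))
      = (\<Prod>j\<in>{1..s}. if k j = l j then 1 else 0)"
    unfolding wal_mult_cnj_eq_prod
    by (subst box_integral_prod(2)) (simp_all only: wal1_mult_cnj_integrable unit_integral_wal1[OF assms(1)])
  also have "\<dots> = (if k = l then 1 else 0)"
  proof (cases "k = l")
    case False
    \<comment> \<open>Extensional functions that differ do so at an index in \<open>{1..s}\<close>;
      orthogonality in that coordinate gives a zero factor.\<close>
    then obtain j where "j \<in> {1..s}" "k j \<noteq> l j"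
      using assms(2,3) unfolding freqs_def by (metis PiE_ext)
    then show ?thesis using False by (auto intro!: prod_zero)
  qed simp
  finally show ?thesis .
qed

lemma countable_freqs: "countable (freqs s)"
  unfolding freqs_def by (intro countable_PiE) auto

lemma infinite_freqs:
  assumes "s \<ge> 1"
  shows "infinite (freqs s)"
proof -
  have "inj (\<lambda>n. \<lambda>j\<in>{1..s}. n :: nat)"
    using assms by (intro injI) (auto dest!: fun_cong[of _ _ 1])
  moreover have "range (\<lambda>n. \<lambda>j\<in>{1..s}. n) \<subseteq> freqs s"
    by (auto simp: freqs_def)
  ultimately show ?thesis
    using infinite_super range_inj_infinite by blast
qed

text \<open>Integrating term by term, orthonormality leaves the term at \<open>l\<close> only. All
  Walsh functions have modulus 1, so the indicator of the box times \<open>norm (c k)\<close>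
  dominates.\<close>

lemma walsh_coeff_infsum:
  assumes "b \<ge> 2" "s \<ge> 1" "(\<lambda>k. norm (c k)) summable_on freqs s" "l \<in> freqs s"
  shows "walsh_coeff b s (\<lambda>x. \<Sum>\<^sub>\<infinity>k\<in>freqs s. c k * wal b s k x) l = c l"
proof -
  let ?M = "Pi\<^sub>M {1..s} (\<lambda>_. lborel :: real measure)"
  let ?h = "\<lambda>k x. c k * (indicator (unit_box s) x *\<^sub>R (wal b s k x * cnj (wal b s l x)))"
  have box: "integrable ?M (\<lambda>x. indicator (unit_box s) x *\<^sub>R (wal b s k x * cnj (wal b s l x)))" for k
    using box_integral_prod(1)[of s "\<lambda>j y. wal1 b (k j) y * cnj (wal1 b (l j) y)"]
    unfolding wal_mult_cnj_eq_prod by (simp only: wal1_mult_cnj_integrable set_integrable_def[of "Pi\<^sub>M _ _"])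
  have "walsh_coeff b s (\<lambda>x. \<Sum>\<^sub>\<infinity>k\<in>freqs s. c k * wal b s k x) l
      = (LINT x|?M. (\<Sum>\<^sub>\<infinity>k\<in>freqs s. ?h k x))"
    unfolding walsh_coeff_def box_integral_def set_lebesgue_integral_def
    by (intro Bochner_Integration.integral_cong refl)
       (simp add: scaleR_conv_of_real mult.assoc mult.left_commute
         flip: infsum_cmult_left' infsum_cmult_right')
  also have "\<dots> = (\<Sum>\<^sub>\<infinity>k\<in>freqs s. integral\<^sup>L ?M (?h k))"
  proof (rule integral_infsum_dominated[OF countable_freqs infinite_freqs[OF assms(2)] _ _ _ assms(3)])
    show "integrable ?M (?h k)" for k
      by (intro integrable_mult_right box)
    \<comment> \<open>The norm of this function is the indicator itself, whose integrability is thus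
      the case \<open>k = l\<close> of \<open>box\<close>.\<close>
    have "integrable ?M (\<lambda>x. norm (indicator (unit_box s) x *\<^sub>R (wal b s l x * cnj (wal b s l x))))"
      by (intro integrable_norm box)
    then show "integrable ?M (\<lambda>x. indicator (unit_box s) x :: real)"
      by (simp add: norm_mult)
  qed (auto simp: norm_mult)
  also have "\<dots> = (\<Sum>\<^sub>\<infinity>k\<in>freqs s. if k = l then c l else 0)"
  proof (rule infsum_cong)
    fix k assume k: "k \<in> freqs s"
    have "integral\<^sup>L ?M (?h k) = c k * box_integral s (\<lambda>x. wal b s k x * cnj (wal b s l x))"
      unfolding box_integral_def set_lebesgue_integral_def by (rule integral_mult_right_zero)
    then show "integral\<^sup>L ?M (?h k) = (if k = l then c l else 0)"
      by (simp add: box_integral_wal[OF assms(1) k assms(4)])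
  qed
  also have "\<dots> = c l"
    by (intro infsumI has_sum_finite_neutralI[of "{l}"]) (use assms(4) in auto)
  finally show ?thesis .
qed

section \<open>Walsh sums over a polynomial lattice\<close>

text \<open>The digits put \<open>h < b ^ m\<close> in bijection with the m-tuples of digits, so a
  sum of products over single digits factorizes.\<close>

lemma sum_prod_nat_digit:
  fixes g :: "nat \<Rightarrow> nat \<Rightarrow> 'a::comm_semiring_1"
  shows "(\<Sum>h<b ^ m. \<Prod>i<m. g i (nat_digit b h i)) = (\<Prod>i<m. \<Sum>d<b. g i d)"
proof (induction m)
  case 0
  then show ?case by (simp add: lessThan_Suc)
next
  case (Suc m)
  have "(\<Sum>h<b ^ Suc m. \<Prod>i<Suc m. g i (nat_digit b h i))
      = (\<Sum>d<b. \<Sum>h<b ^ m. \<Prod>i<Suc m. g i (nat_digit b (d * b ^ m + h) i))"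
    by (simp only: power_Suc sum_lessThan_mult_block)
  also have "\<dots> = (\<Sum>d<b. \<Sum>h<b ^ m. (\<Prod>i<m. g i (nat_digit b h i)) * g m d)"
    by (intro sum.cong refl) (simp add: nat_digit_block)
  also have "\<dots> = (\<Prod>i<Suc m. \<Sum>d<b. g i d)"
    by (simp add: Suc.IH flip: sum_distrib_right sum_distrib_left)
  finally show ?case .
qed

text \<open>A finite digit string is recovered exactly, because its continuation by zeros is an
  admissible expansion. Both claims go through one induction: prepending a digit to \<open>y\<close>
  by \<open>frac_digit_shift\<close> requires 0 <= y < 1.\<close>

lemma digit_series_unit_interval:
  assumes "b \<ge> 2" "\<And>i. i < n \<Longrightarrow> d i < b"
  shows "(\<Sum>i<n. real (d i) / real b ^ Suc i) \<in> {0..<1}"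
    and "frac_digit b (\<Sum>i<n. real (d i) / real b ^ Suc i) (Suc j) = (if j < n then d j else 0)"
proof -
  have "(\<Sum>i<n. real (d i) / real b ^ Suc i) \<in> {0..<1} \<and>
    (\<forall>j. frac_digit b (\<Sum>i<n. real (d i) / real b ^ Suc i) (Suc j) = (if j < n then d j else 0))"
    using assms(2)
  proof (induction n arbitrary: d)
    case 0
    then show ?case by (simp add: frac_digit_def)
  next
    case (Suc n)
    define y where "y = (\<Sum>i<n. real (d (Suc i)) / real b ^ Suc i)"
    have y: "0 \<le> y" "y < 1"
      and dig: "frac_digit b y (Suc j) = (if j < n then d (Suc j) else 0)" for j
      using Suc.IH[of "\<lambda>i. d (Suc i)"] Suc.prems by (auto simp: y_def)
    have d0: "d 0 < b" using Suc.prems by simp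
    have eq: "(\<Sum>i<Suc n. real (d i) / real b ^ Suc i) = (real (d 0) + y) / real b"
      by (simp only: sum.lessThan_Suc_shift y_def)
         (simp add: add_divide_distrib sum_divide_distrib mult.commute)
    have "real (d 0) + y < real b"
      using d0 y by linarith
    then have "(real (d 0) + y) / real b \<in> {0..<1}"
      using assms(1) y by simp
    moreover have "frac_digit b ((real (d 0) + y) / real b) (Suc j) = (if j < Suc n then d j else 0)" for j
      by (cases j) (simp_all add: frac_digit_shift[OF assms(1) d0 y] dig)
    ultimately show ?case unfolding eq by blast
  qed
  then show "(\<Sum>i<n. real (d i) / real b ^ Suc i) \<in> {0..<1}"
    and "frac_digit b (\<Sum>i<n. real (d i) / real b ^ Suc i) (Suc j) = (if j < n then d j else 0)"
    by auto
qed

section \<open>The prime field and its additive character\<close>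

definition nat_of_mod_ring :: "'b::prime_card mod_ring \<Rightarrow> nat" where
  "nat_of_mod_ring a = nat (to_int_mod_ring a)"

lemma to_int_mod_ring_bounds:
  fixes a :: "'b::prime_card mod_ring"
  shows "0 \<le> to_int_mod_ring a" "to_int_mod_ring a < int CARD('b)"
  using range_to_int_mod_ring[where 'a = 'b] by auto

lemma nat_of_mod_ring_less: "nat_of_mod_ring (a :: 'b::prime_card mod_ring) < CARD('b)"
  using to_int_mod_ring_bounds[of a] by (simp add: nat_of_mod_ring_def nat_less_iff)

lemma of_nat_nat_of_mod_ring [simp]: "of_nat (nat_of_mod_ring a) = a"
  using to_int_mod_ring_bounds[of a]
  by (simp add: nat_of_mod_ring_def of_nat_of_int_mod_ring)

lemma nat_of_mod_ring_of_nat: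
  "nat_of_mod_ring (of_nat t :: 'b::prime_card mod_ring) = t mod CARD('b)"
proof -
  have "to_int_mod_ring (of_nat t :: 'b mod_ring) = int t mod int CARD('b)"
    by transfer simp
  then show ?thesis
    by (simp add: nat_of_mod_ring_def flip: zmod_int)
qed

text \<open>The additive character a -> exp(2 pi i a / b) of F_b, computed on the representative in
  {0, ..., b - 1}.\<close>

definition mod_ring_char :: "'b::prime_card mod_ring \<Rightarrow> complex" where
  "mod_ring_char a = unity_root CARD('b) (nat_of_mod_ring a)"

lemma mod_ring_char_of_nat:
  "mod_ring_char (of_nat t :: 'b::prime_card mod_ring) = unity_root CARD('b) t"
  by (simp add: mod_ring_char_def nat_of_mod_ring_of_nat unity_root_mod)

lemma mod_ring_char_0 [simp]: "mod_ring_char 0 = 1"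
  using mod_ring_char_of_nat[of 0] by simp

lemma mod_ring_char_add:
  fixes a c :: "'b::prime_card mod_ring"
  shows "mod_ring_char (a + c) = mod_ring_char a * mod_ring_char c"
proof -
  have "mod_ring_char (a + c) = mod_ring_char (of_nat (nat_of_mod_ring a + nat_of_mod_ring c) :: 'b mod_ring)"
    by simp
  also have "\<dots> = mod_ring_char a * mod_ring_char c"
    unfolding mod_ring_char_of_nat unity_root_add by (simp add: mod_ring_char_def)
  finally show ?thesis .
qed

lemma mod_ring_char_sum: "mod_ring_char (\<Sum>i\<in>A. f i) = (\<Prod>i\<in>A. mod_ring_char (f i))"
  by (induction A rule: infinite_finite_induct) (simp_all add: mod_ring_char_add)

lemma mod_ring_char_of_nat_mult: "mod_ring_char (of_nat t * a) = mod_ring_char a ^ t"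
  by (induction t) (simp_all add: mod_ring_char_add algebra_simps)

lemma mod_ring_char_power_card: "mod_ring_char (a :: 'b::prime_card mod_ring) ^ CARD('b) = 1"
  by (simp flip: mod_ring_char_of_nat_mult)

lemma laurent_trunc_eq:
  fixes w :: "'b::prime_card mod_ring fls"
  shows "laurent_trunc n w = (\<Sum>i<n. real (nat_of_mod_ring (fls_nth w (int (Suc i)))) / real CARD('b) ^ Suc i)"
proof -
  have "real_of_int (to_int_mod_ring a) = real (nat_of_mod_ring a)" for a :: "'b mod_ring"
    using to_int_mod_ring_bounds[of a] by (simp add: nat_of_mod_ring_def)
  moreover have "{1..n} = Suc ` {..<n}"
    by (simp add: image_Suc_lessThan)
  ultimately show ?thesis
    by (simp add: laurent_trunc_def sum.reindex)
qed

lemma card_prime_card_ge_2: "CARD('b::prime_card) \<ge> 2"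
  using nontriv[where 'a = 'b] by simp

lemma laurent_trunc_unit_interval:
  "laurent_trunc n (w :: 'b::prime_card mod_ring fls) \<in> {0..<1}"
  unfolding laurent_trunc_eq
  by (intro digit_series_unit_interval card_prime_card_ge_2 nat_of_mod_ring_less)

text \<open>A linear form in \<open>w\<close> over F_b that pairs the digits of \<open>k\<close>
  with the coefficients of X^-1, X^-2, and so on. The cut-off at \<open>n\<close> reflects the zero
  digits after truncation, and \<open>i < k\<close> reaches all nonzero digits because k <
  b^k.\<close>

definition walsh_form :: "nat \<Rightarrow> nat \<Rightarrow> 'b::prime_card mod_ring fls \<Rightarrow> 'b mod_ring" where
  "walsh_form n k w = (\<Sum>i<k. if i < n then of_nat (nat_digit CARD('b) k i) * fls_nth w (int (Suc i)) else 0)"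

lemma walsh_form_add: "walsh_form n k (v + w) = walsh_form n k v + walsh_form n k w"
  unfolding walsh_form_def sum.distrib[symmetric] by (intro sum.cong refl) (simp add: algebra_simps)

lemma walsh_form_0 [simp]: "walsh_form n k 0 = 0"
  unfolding walsh_form_def by (intro sum.neutral) auto

lemma walsh_form_sum: "walsh_form n k (\<Sum>i\<in>A. f i) = (\<Sum>i\<in>A. walsh_form n k (f i))"
  by (induction A rule: infinite_finite_induct) (simp_all add: walsh_form_add)

lemma walsh_form_mult_const: "walsh_form n k (fls_const c * w) = c * walsh_form n k w"
  unfolding walsh_form_def sum_distrib_left by (intro sum.cong refl) (simp add: mult_ac)

text \<open>The truncated number has the digits w_1, ..., w_n followed by zeros, so the exponent of
  the Walsh function is the linear form read modulo b.\<close>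

lemma wal1_laurent_trunc:
  fixes w :: "'b::prime_card mod_ring fls"
  shows "wal1 CARD('b) k (laurent_trunc n w) = mod_ring_char (walsh_form n k w)"
proof -
  have "wal1 CARD('b) k (laurent_trunc n w)
     = (\<Prod>i<k. unity_root CARD('b) ((if i < n then nat_of_mod_ring (fls_nth w (int (Suc i))) else 0) *
          nat_digit CARD('b) k i))"
    using card_prime_card_ge_2[where 'b = 'b]
    by (subst wal1_eq_prod[of _ _ k])
       (simp_all only: power_gt_expt laurent_trunc_eq digit_series_unit_interval nat_of_mod_ring_less)
  also have "\<dots> = (\<Prod>i<k. mod_ring_char (if i < n then of_nat (nat_digit CARD('b) k i) * fls_nth w (int (Suc i)) else 0))"
    by (intro prod.cong refl) (simp add: unity_root_mult mod_ring_char_of_nat_mult flip: mod_ring_char_def)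
  finally show ?thesis by (simp add: walsh_form_def mod_ring_char_sum)
qed

lemma poly_to_laurent_digit_poly:
  "poly_to_laurent (digit_poly m h :: 'b::prime_card mod_ring poly)
    = (\<Sum>i<m. fls_const (of_nat (nat_digit CARD('b) h i)) * fls_X_inv ^ i)"
proof -
  have add: "poly_to_laurent (f + g) = poly_to_laurent f + poly_to_laurent g" for f g :: "'b mod_ring poly"
  proof -
    have "map_poly fls_const (f + g) = map_poly fls_const f + map_poly fls_const g"
      by (intro poly_eqI) (simp add: coeff_map_poly fls_plus_const)
    then show ?thesis by (simp add: poly_to_laurent_def)
  qed
  have zero: "poly_to_laurent (0 :: 'b mod_ring poly) = 0"
    by (simp add: poly_to_laurent_def)
  have monom: "poly_to_laurent (Polynomial.monom a i) = fls_const a * fls_X_inv ^ i" for a :: "'b mod_ring" and i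
    by (simp add: poly_to_laurent_def map_poly_monom poly_monom)
  have "poly_to_laurent (\<Sum>i\<in>A. f i) = (\<Sum>i\<in>A. poly_to_laurent (f i))" for A :: "nat set" and f :: "nat \<Rightarrow> 'b mod_ring poly"
    by (induction A rule: infinite_finite_induct) (simp_all add: zero add)
  then show ?thesis by (simp add: digit_poly_def monom)
qed

lemma poly_lattice_point_in_box: "poly_lattice_point m n s q p h \<in> unit_box s"
  unfolding poly_lattice_point_def unit_box_def
  by (simp add: restrict_PiE_iff laurent_trunc_unit_interval del: atLeastLessThan_iff)

lemma sum_wal_poly_lattice_nonneg:
  fixes p :: "'b::prime_card mod_ring poly"
  shows "\<exists>r\<ge>0. (\<Sum>h<CARD('b) ^ m. wal CARD('b) s k (poly_lattice_point m n s q p h)) = of_real r"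
proof -
  \<comment> \<open>\<open>W i j\<close> is the series of X^i q_j / p, by which digit i of
    \<open>h\<close> acts on coordinate \<open>j\<close>; \<open>c i\<close> collects its effect on
    all coordinates.\<close>
  define W where "W i j = fls_X_inv ^ i * (poly_to_laurent (q j) / poly_to_laurent p)" for i j
  define c where "c i = (\<Sum>j=1..s. walsh_form n (k j) (W i j))" for i
  have "wal CARD('b) s k (poly_lattice_point m n s q p h)
      = (\<Prod>i<m. mod_ring_char (c i) ^ nat_digit CARD('b) h i)" for h
  proof -
    have "poly_to_laurent (digit_poly m h) * poly_to_laurent (q j) / poly_to_laurent p
        = (\<Sum>i<m. fls_const (of_nat (nat_digit CARD('b) h i)) * W i j)" for j
      unfolding times_divide_eq_right[symmetric] poly_to_laurent_digit_poly W_def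
      by (simp only: sum_distrib_right mult.assoc)
    then have "wal CARD('b) s k (poly_lattice_point m n s q p h) =
      (\<Prod>j\<in>{1..s}. mod_ring_char (\<Sum>i<m. of_nat (nat_digit CARD('b) h i) * walsh_form n (k j) (W i j)))"
      unfolding wal_def poly_lattice_point_def
      by (intro prod.cong refl) (simp add: wal1_laurent_trunc walsh_form_sum walsh_form_mult_const)
    also have "\<dots> = mod_ring_char (\<Sum>i<m. of_nat (nat_digit CARD('b) h i) * c i)"
      unfolding c_def sum_distrib_left mod_ring_char_sum[symmetric] by (subst sum.swap) simp
    finally show ?thesis
      by (simp add: mod_ring_char_sum mod_ring_char_of_nat_mult)
  qed
  then have "(\<Sum>h<CARD('b) ^ m. wal CARD('b) s k (poly_lattice_point m n s q p h))
      = (\<Prod>i<m. \<Sum>d<CARD('b). mod_ring_char (c i) ^ d)"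
    using sum_prod_nat_digit[of "\<lambda>i d. mod_ring_char (c i) ^ d" "CARD('b)" m] by simp
  also have "\<dots> = (\<Prod>i<m. of_real (if mod_ring_char (c i) = 1 then real CARD('b) else 0))"
    by (intro prod.cong refl) (simp add: sum_powers_of_unity mod_ring_char_power_card)
  finally show ?thesis
    by (intro exI[of _ "\<Prod>i<m. if mod_ring_char (c i) = 1 then real CARD('b) else 0"])
       (auto intro: prod_nonneg)
qed

section \<open>The worst-case error\<close>

lemma has_sum_finite_sum:
  fixes f :: "'a \<Rightarrow> 'b \<Rightarrow> 'c::topological_comm_monoid_add"
  assumes "\<And>h. h \<in> H \<Longrightarrow> (f h has_sum S h) A"
  shows "((\<lambda>k. \<Sum>h\<in>H. f h k) has_sum (\<Sum>h\<in>H. S h)) A"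
  using assms by (induction H rule: infinite_finite_induct) (auto intro: has_sum_add)

lemma has_sum_single:
  assumes "z \<in> A"
  shows "((\<lambda>k. if k = z then c else 0) has_sum c) A"
  by (rule has_sum_finite_neutralI[of "{z}"]) (use assms in auto)

text \<open>Frequency vectors are extensional, hence the restriction of the constant 0 to
  \<open>{1..s}\<close>.\<close>

definition zero_freq :: "nat \<Rightarrow> nat \<Rightarrow> nat" where
  "zero_freq s = (\<lambda>j\<in>{1..s}. 0)"

lemma zero_freq_in_freqs: "zero_freq s \<in> freqs s"
  by (simp add: zero_freq_def freqs_def)

lemma wal_zero_freq [simp]: "wal b s (zero_freq s) x = 1"
  by (simp add: wal_def zero_freq_def)

lemma decay_zero_freq [simp]: "decay b \<alpha> s \<gamma> (zero_freq s) = 1"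
  by (simp add: decay_eq_prod zero_freq_def decay_factor_def)

lemma walsh_coeff_zero_freq: "walsh_coeff b s f (zero_freq s) = box_integral s f"
  by (simp add: walsh_coeff_def)

text \<open>Defined by the closed product instead of its Walsh series, so that its average over the
  nodes is already the one in the theorem.\<close>

definition extremal :: "nat \<Rightarrow> nat \<Rightarrow> nat \<Rightarrow> (nat \<Rightarrow> real) \<Rightarrow> (nat \<Rightarrow> real) \<Rightarrow> complex" where
  "extremal b \<alpha> s \<gamma> x = (\<Prod>j\<in>{1..s}. 1 + of_real (\<gamma> j) * walsh_omega b \<alpha> (x j))"

lemma walsh_coeff_extremal:
  assumes "b \<ge> 2" "\<alpha> \<ge> 2" "s \<ge> 1" "\<And>j. j \<in> {1..s} \<Longrightarrow> \<gamma> j > 0" "k \<in> freqs s"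
  shows "walsh_coeff b s (extremal b \<alpha> s \<gamma>) k = of_real (decay b \<alpha> s \<gamma> k)"
proof -
  have "decay b \<alpha> s \<gamma> summable_on freqs s"
    using assms(1,2,4) by (rule decay_summable)
  moreover have "decay b \<alpha> s \<gamma> k \<ge> 0" for k
    by (rule less_imp_le[OF decay_pos[OF assms(1)]]) (rule assms(4))
  ultimately have "(\<lambda>k. norm (complex_of_real (decay b \<alpha> s \<gamma> k))) summable_on freqs s"
    by simp
  from walsh_coeff_infsum[OF assms(1,3) this assms(5)]
  have "walsh_coeff b s (\<lambda>x. \<Sum>\<^sub>\<infinity>k\<in>freqs s. of_real (decay b \<alpha> s \<gamma> k) * wal b s k x) k
      = of_real (decay b \<alpha> s \<gamma> k)" .
  moreover have "extremal b \<alpha> s \<gamma> x = (\<Sum>\<^sub>\<infinity>k\<in>freqs s. of_real (decay b \<alpha> s \<gamma> k) * wal b s k x)" for x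
    unfolding extremal_def using assms(1,2,4) by (intro infsumI[symmetric] decay_wal_has_sum)
  ultimately show ?thesis by presburger
qed

lemma extremal_in_walsh_space:
  assumes "b \<ge> 2" "\<alpha> \<ge> 2" "s \<ge> 1" "\<And>j. j \<in> {1..s} \<Longrightarrow> \<gamma> j > 0"
  shows "walsh_norm b \<alpha> s \<gamma> (extremal b \<alpha> s \<gamma>) \<le> 1"
    and "extremal b \<alpha> s \<gamma> \<in> walsh_space b \<alpha> s \<gamma>"
proof -
  have pos: "decay b \<alpha> s \<gamma> k > 0" for k
    by (rule decay_pos[OF assms(1)]) (rule assms(4))
  have coeff: "walsh_coeff b s (extremal b \<alpha> s \<gamma>) k = of_real (decay b \<alpha> s \<gamma> k)" if "k \<in> freqs s" for k
    using assms that by (rule walsh_coeff_extremal)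
  have has_sum: "((\<lambda>k. of_real (decay b \<alpha> s \<gamma> k) * wal b s k x) has_sum extremal b \<alpha> s \<gamma> x) (freqs s)" for x
    unfolding extremal_def using assms(1,2,4) by (rule decay_wal_has_sum)
  show norm: "walsh_norm b \<alpha> s \<gamma> (extremal b \<alpha> s \<gamma>) \<le> 1"
    unfolding walsh_norm_def
  proof (rule SUP_least)
    fix k assume "k \<in> freqs s"
    then show "ereal (cmod (walsh_coeff b s (extremal b \<alpha> s \<gamma>) k) / decay b \<alpha> s \<gamma> k) \<le> 1"
      using pos[of k] by (simp add: coeff)
  qed
  have "((\<lambda>k. walsh_coeff b s (extremal b \<alpha> s \<gamma>) k * wal b s k x) has_sum extremal b \<alpha> s \<gamma> x) (freqs s)" for x
    using has_sum by (subst has_sum_cong) (auto simp: coeff)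
  moreover have "(\<lambda>k. cmod (walsh_coeff b s (extremal b \<alpha> s \<gamma>) k * wal b s k x)) summable_on freqs s" for x
  proof -
    have "decay b \<alpha> s \<gamma> summable_on freqs s"
      using assms(1,2,4) by (rule decay_summable)
    then show ?thesis
      using pos by (subst summable_on_cong[where g = "decay b \<alpha> s \<gamma>"]) (auto simp: coeff norm_mult less_imp_le)
  qed
  moreover have "walsh_norm b \<alpha> s \<gamma> (extremal b \<alpha> s \<gamma>) < \<infinity>"
    using norm by (rule le_less_trans) simp
  ultimately show "extremal b \<alpha> s \<gamma> \<in> walsh_space b \<alpha> s \<gamma>"
    by (simp add: walsh_space_def)
qed

text \<open>Duality of a weighted supremum and a weighted l^1 sum: if every |f_k| is at most r(k), a
  functional with nonnegative weights is largest at f_k = r(k). The final equation, being complex,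
  also asserts that its right-hand side is real.\<close>

lemma worst_case_error_extremal:
  assumes "b \<ge> 2" "\<alpha> \<ge> 2" "s \<ge> 1" and \<gamma>: "\<And>j. j \<in> {1..s} \<Longrightarrow> \<gamma> j > 0" and "N > 0"
    and box: "\<And>h. h < N \<Longrightarrow> x h \<in> unit_box s"
    and nonneg: "\<And>k. k \<in> freqs s \<Longrightarrow> \<exists>r\<ge>0. (\<Sum>h<N. wal b s k (x h)) = of_real r"
  shows "\<exists>e. worst_case_error b \<alpha> s \<gamma> N x = ereal e \<and>
    complex_of_real e = - 1 + (\<Sum>h<N. extremal b \<alpha> s \<gamma> (x h)) / of_nat N"
proof -
  define z where "z = zero_freq s"
  have z: "z \<in> freqs s" by (simp add: z_def zero_freq_in_freqs)
  define \<sigma> where "\<sigma> k = Re (\<Sum>h<N. wal b s k (x h)) / real N" for k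
  have \<sigma>: "\<sigma> k \<ge> 0" "(\<Sum>h<N. wal b s k (x h)) / of_nat N = of_real (\<sigma> k)" if k: "k \<in> freqs s" for k
  proof -
    obtain r where r: "r \<ge> 0" "(\<Sum>h<N. wal b s k (x h)) = of_real r"
      using nonneg[OF k] by blast
    show "\<sigma> k \<ge> 0" "(\<Sum>h<N. wal b s k (x h)) / of_nat N = of_real (\<sigma> k)"
      unfolding \<sigma>_def r(2) using r(1) by simp_all
  qed
  have \<sigma>z: "\<sigma> z = 1" using \<open>N > 0\<close> by (simp add: \<sigma>_def z_def)
  define Q where "Q f = (\<Sum>h<N. f (x h)) / of_nat N" for f :: "(nat \<Rightarrow> real) \<Rightarrow> complex"
  \<comment> \<open>The integral is the coefficient at \<open>z\<close>, so subtracting it lowers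
    the weight there from \<open>\<sigma> z\<close> = 1 to 0. The error becomes one series over all
    of \<open>freqs s\<close>, with no index removed.\<close>
  have Q: "((\<lambda>k. walsh_coeff b s f k * of_real (\<sigma> k - (if k = z then 1 else 0)))
      has_sum (Q f - box_integral s f)) (freqs s)" if f: "f \<in> walsh_space b \<alpha> s \<gamma>" for f
  proof -
    have "((\<lambda>k. \<Sum>h<N. walsh_coeff b s f k * wal b s k (x h)) has_sum (\<Sum>h<N. f (x h))) (freqs s)"
      using f box by (intro has_sum_finite_sum) (auto simp: walsh_space_def)
    then have "((\<lambda>k. (\<Sum>h<N. walsh_coeff b s f k * wal b s k (x h)) / of_nat N) has_sum Q f) (freqs s)"
      unfolding Q_def by (rule has_sum_divide_const)
    moreover have "((\<lambda>k. if k = z then - walsh_coeff b s f z else 0) has_sum (- walsh_coeff b s f z)) (freqs s)"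
      using z by (rule has_sum_single)
    ultimately have "((\<lambda>k. (\<Sum>h<N. walsh_coeff b s f k * wal b s k (x h)) / of_nat N +
        (if k = z then - walsh_coeff b s f z else 0)) has_sum (Q f + - walsh_coeff b s f z)) (freqs s)"
      by (rule has_sum_add)
    moreover have "(\<Sum>h<N. walsh_coeff b s f k * wal b s k (x h)) / of_nat N +
        (if k = z then - walsh_coeff b s f z else 0) =
        walsh_coeff b s f k * of_real (\<sigma> k - (if k = z then 1 else 0))" if "k \<in> freqs s" for k
      using \<sigma>(2)[OF that] by (simp add: algebra_simps flip: sum_distrib_left times_divide_eq_right)
    ultimately show ?thesis
      unfolding z_def by (subst has_sum_cong) (auto simp: walsh_coeff_zero_freq)
  qed
  let ?F = "extremal b \<alpha> s \<gamma>"
  have F_norm: "walsh_norm b \<alpha> s \<gamma> ?F \<le> 1"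
    using assms(1-4) by (rule extremal_in_walsh_space(1))
  have F: "?F \<in> walsh_space b \<alpha> s \<gamma>"
    using assms(1-4) by (rule extremal_in_walsh_space(2))
  have coeffF: "walsh_coeff b s ?F k = of_real (decay b \<alpha> s \<gamma> k)" if "k \<in> freqs s" for k
    using assms(1-4) that by (rule walsh_coeff_extremal)
  define e where "e = Re (Q ?F) - 1"
  have IF: "box_integral s ?F = 1"
    using coeffF[OF z] by (simp add: z_def walsh_coeff_zero_freq)
  have pos: "decay b \<alpha> s \<gamma> k > 0" for k
    by (rule decay_pos[OF assms(1)]) (rule \<gamma>)
  \<comment> \<open>The error series of \<open>extremal\<close>: its term at \<open>z\<close> is 0,
    and it majorizes the error series of every \<open>f\<close> in the unit ball.\<close>
  define w where "w k = decay b \<alpha> s \<gamma> k * (\<sigma> k - (if k = z then 1 else 0))" for k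
  have w: "w k \<ge> 0" if "k \<in> freqs s" for k
    using \<sigma>(1)[OF that] \<sigma>z pos[of k] by (simp add: w_def)
  have wF: "((\<lambda>k. complex_of_real (w k)) has_sum (Q ?F - 1)) (freqs s)"
    using Q[OF F] unfolding IF by (subst (asm) has_sum_cong) (auto simp: coeffF w_def)
  then have we: "(w has_sum e) (freqs s)"
    using has_sum_Re[OF wF] by (simp add: e_def)
  \<comment> \<open>So far \<open>e\<close> is only a real part; a sum of real terms is real, so
    nothing is lost.\<close>
  then have Qe: "Q ?F - 1 = of_real e"
    using has_sum_unique[OF wF has_sum_of_real[OF we]] by simp
  have e0: "e \<ge> 0"
    using we w by (rule has_sum_nonneg)
  have "worst_case_error b \<alpha> s \<gamma> N x = ereal e"
  proof (rule antisym)
    show "worst_case_error b \<alpha> s \<gamma> N x \<le> ereal e"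
      unfolding worst_case_error_def
    proof (rule SUP_least)
      fix f assume "f \<in> {f \<in> walsh_space b \<alpha> s \<gamma>. walsh_norm b \<alpha> s \<gamma> f \<le> 1}"
      then have f: "f \<in> walsh_space b \<alpha> s \<gamma>" and nf: "walsh_norm b \<alpha> s \<gamma> f \<le> 1" by auto
      have "norm (Q f - box_integral s f) \<le> e"
      proof (rule norm_infsum_le[OF Q[OF f] we])
        fix k assume k: "k \<in> freqs s"
        have "ereal (cmod (walsh_coeff b s f k) / decay b \<alpha> s \<gamma> k) \<le> 1"
          by (rule order_trans[OF SUP_upper[OF k] nf[unfolded walsh_norm_def]])
        then have "cmod (walsh_coeff b s f k) \<le> decay b \<alpha> s \<gamma> k"
          using pos[of k] by (simp add: one_ereal_def)
        moreover have "\<sigma> k - (if k = z then 1 else 0) \<ge> 0"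
          using \<sigma>(1)[OF k] \<sigma>z by auto
        ultimately show "norm (walsh_coeff b s f k * of_real (\<sigma> k - (if k = z then 1 else 0))) \<le> w k"
          unfolding w_def norm_mult norm_of_real by (intro mult_mono) (auto intro: less_imp_le[OF pos])
      qed
      then show "ereal (cmod (box_integral s f - (\<Sum>h<N. f (x h)) / of_nat N)) \<le> ereal e"
        by (simp add: Q_def norm_minus_commute)
    qed
    have "ereal e = ereal (cmod (box_integral s ?F - (\<Sum>h<N. ?F (x h)) / of_nat N))"
    proof -
      have "box_integral s ?F - (\<Sum>h<N. ?F (x h)) / of_nat N = - of_real e"
        unfolding IF Qe[symmetric] by (simp add: Q_def)
      then show ?thesis using e0 by simp
    qed
    also have "\<dots> \<le> worst_case_error b \<alpha> s \<gamma> N x"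
      unfolding worst_case_error_def by (rule SUP_upper) (use F F_norm in auto)
    finally show "ereal e \<le> worst_case_error b \<alpha> s \<gamma> N x" .
  qed
  moreover have "complex_of_real e = - 1 + (\<Sum>h<N. ?F (x h)) / of_nat N"
    using Qe by (simp add: Q_def algebra_simps)
  ultimately show ?thesis by blast
qed

theorem lemma1:
  fixes b \<alpha> s m n :: nat
    and \<gamma> :: "nat \<Rightarrow> real"
    and p :: "'b::prime_card mod_ring poly"
    and q :: "nat \<Rightarrow> 'b mod_ring poly"
  assumes "b = CARD('b)"
    and "\<alpha> > 1"
    and "s \<ge> 1"
    and "1 \<le> m" and "m \<le> n"
    and "\<And>j. j \<ge> 1 \<Longrightarrow> \<gamma> j > 0"
    and "Factorial_Ring.irreducible p"
    and "Polynomial.degree p = n"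
  shows "\<exists>e :: real.
    worst_case_error b \<alpha> s \<gamma> (b ^ m) (poly_lattice_point m n s q p) = ereal e \<and>
    complex_of_real e =
      - 1 + 1 / of_nat (b ^ m) * (\<Sum>h<b ^ m. \<Prod>j=1..s.
        1 + of_real (\<gamma> j) * walsh_omega b \<alpha> (poly_lattice_point m n s q p h j))"
proof -
  have b: "b \<ge> 2" using assms(1) card_prime_card_ge_2[where 'b = 'b] by simp
  have "\<exists>e. worst_case_error b \<alpha> s \<gamma> (b ^ m) (poly_lattice_point m n s q p) = ereal e \<and>
    complex_of_real e = - 1 + (\<Sum>h<b ^ m. extremal b \<alpha> s \<gamma> (poly_lattice_point m n s q p h)) / of_nat (b ^ m)"
  proof (rule worst_case_error_extremal)
    show "\<exists>r\<ge>0. (\<Sum>h<b ^ m. wal b s k (poly_lattice_point m n s q p h)) = of_real r" for k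
      unfolding assms(1) by (rule sum_wal_poly_lattice_nonneg)
  qed (use b assms poly_lattice_point_in_box in auto)
  then show ?thesis by (simp add: extremal_def)
qed

end
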